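(* Let $\mathbb{K}\in\{\mathbb{R},\mathbb{C}\}$ and let $T\in\mathbb{K}^{d\times r}$ be a tight random g-frame of order $1$ such that $\|T\|_{HS}^2=R$ for some positive constant $R$. Let $\{T_j\}_{j=1}^n$ be independent copies of $T$. For each fixed $\varepsilon\in(0,1]$ there are positive constants $\gamma_\varepsilon,c_\varepsilon>0$ such that for all $n\ge c_\varepsilon d\ln(d)$ the g-frame operator $S_n=\sum_{j=1}^n\frac{d}{nR}T_jT_j^*$ of the scaled collection $\{\sqrt{\tfrac{d}{nR}}T_j\}_{j=1}^n$ satisfies $\|I_d-S_n\|_\infty<\varepsilon$ with probability at least $1-e^{-\gamma_\varepsilon n/d}$.
   Context: A random matrix $T\in\mathbb{K}^{d\times r}$ is a random g-frame of order $p$ (integer $p\ge1$) if there are constants $A_p,B_p>0$ with $A_p\|x\|^{2p}\le\mathbb{E}\|T^*x\|^{2p}\le B_p\|x\|^{2p}$ for all $x\in\mathbb{K}^d$; it is tight if one can take $A_p=B_p$. $\|\cdot\|_{HS}$ is the Hilbert–Schmidt norm and $\|\cdot\|_\infty$ the spectral (operator) norm. *)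

theory Defs
  imports "HOL-Probability.Probability"
begin

text \<open>Conventions. The scalar field K is represented as a subset of the complex numbers:
  K = Reals (real case) or K = UNIV (complex case).
  A d x r matrix is a function on index pairs (i,k) with i < d, k < r; the measurable
  space of such matrices is the finite product of Borel sigma algebras on C.
  A vector of K^d is a function nat => complex whose first d entries lie in K
  (entries beyond d are ignored).\<close>

definition matspace :: "nat \<Rightarrow> nat \<Rightarrow> (nat \<times> nat \<Rightarrow> complex) measure" where
  "matspace d r = PiM ({..<d} \<times> {..<r}) (\<lambda>_. borel)"

definition kvecs :: "complex set \<Rightarrow> nat \<Rightarrow> (nat \<Rightarrow> complex) set" where
  "kvecs K d = {x. \<forall>i<d. x i \<in> K}"

definition kmats :: "complex set \<Rightarrow> nat \<Rightarrow> nat \<Rightarrow> (nat \<times> nat \<Rightarrow> complex) set" where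
  "kmats K d r = {A. \<forall>i<d. \<forall>k<r. A (i,k) \<in> K}"

definition vnorm :: "nat \<Rightarrow> (nat \<Rightarrow> complex) \<Rightarrow> real" where
  "vnorm d x = sqrt (\<Sum>i<d. (cmod (x i))\<^sup>2)"

definition adj_mult :: "nat \<Rightarrow> (nat \<times> nat \<Rightarrow> complex) \<Rightarrow> (nat \<Rightarrow> complex) \<Rightarrow> (nat \<Rightarrow> complex)" where
  "adj_mult d T x = (\<lambda>k. \<Sum>i<d. cnj (T (i,k)) * x i)"

definition mat_mult_vec :: "nat \<Rightarrow> (nat \<times> nat \<Rightarrow> complex) \<Rightarrow> (nat \<Rightarrow> complex) \<Rightarrow> (nat \<Rightarrow> complex)" where
  "mat_mult_vec d M x = (\<lambda>i. \<Sum>l<d. M (i,l) * x l)"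

definition hs_norm_sq :: "nat \<Rightarrow> nat \<Rightarrow> (nat \<times> nat \<Rightarrow> complex) \<Rightarrow> real" where
  "hs_norm_sq d r T = (\<Sum>i<d. \<Sum>k<r. (cmod (T (i,k)))\<^sup>2)"

definition spec_norm :: "complex set \<Rightarrow> nat \<Rightarrow> (nat \<times> nat \<Rightarrow> complex) \<Rightarrow> real" where
  "spec_norm K d M = Sup {vnorm d (mat_mult_vec d M x) | x. x \<in> kvecs K d \<and> vnorm d x = 1}"

text \<open>A random matrix in K^{d x r}, given by its distribution D, is a random g-frame of
  order p with bounds A, B.\<close>
definition rgframe_bounds ::
  "complex set \<Rightarrow> nat \<Rightarrow> nat \<Rightarrow> (nat \<times> nat \<Rightarrow> complex) measure \<Rightarrow> nat \<Rightarrow> real \<Rightarrow> real \<Rightarrow> bool" where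
  "rgframe_bounds K d r D p A B \<longleftrightarrow> A > 0 \<and> B > 0 \<and>
     (\<forall>x \<in> kvecs K d.
        A * vnorm d x ^ (2*p) \<le> (\<integral>T. vnorm r (adj_mult d T x) ^ (2*p) \<partial>D) \<and>
        (\<integral>T. vnorm r (adj_mult d T x) ^ (2*p) \<partial>D) \<le> B * vnorm d x ^ (2*p))"

definition tight_rgframe ::
  "complex set \<Rightarrow> nat \<Rightarrow> nat \<Rightarrow> (nat \<times> nat \<Rightarrow> complex) measure \<Rightarrow> nat \<Rightarrow> bool" where
  "tight_rgframe K d r D p \<longleftrightarrow> (\<exists>A. rgframe_bounds K d r D p A A)"

definition frame_op ::
  "nat \<Rightarrow> nat \<Rightarrow> real \<Rightarrow> nat \<Rightarrow> (nat \<Rightarrow> nat \<times> nat \<Rightarrow> complex) \<Rightarrow> (nat \<times> nat \<Rightarrow> complex)" where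
  "frame_op d r R n Ts = (\<lambda>(i,l). \<Sum>j<n. complex_of_real (real d / (real n * R)) *
        (\<Sum>k<r. Ts j (i,k) * cnj (Ts j (l,k))))"

definition id_minus :: "nat \<Rightarrow> (nat \<times> nat \<Rightarrow> complex) \<Rightarrow> (nat \<times> nat \<Rightarrow> complex)" where
  "id_minus d M = (\<lambda>(i,l). (if i = l then 1 else 0) - M (i,l))"

end

theory Submission
  imports Defs
begin

text \<open>
  Matrix Chernoff bound by trace moments. Let \<open>Y = T T\<^sup>* / R\<close>, so that \<open>0 \<le> Y \<le> I\<close> almost surely
  and, by tightness, \<open>E Y = I / d\<close>. For \<open>A \<ge> 0\<close> and \<open>0 \<le> Y \<le> I\<close> one has
  \<open>tr (A + Y)\<^sup>p \<le> tr A\<^sup>p + tr (Y ((A + I)\<^sup>p - A\<^sup>p))\<close>; taking expectations with \<open>E Y = \<mu> I\<close>, this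
  replaces \<open>Y\<close> by a Bernoulli multiple of the identity. Hence all trace moments of a sum of \<open>n\<close>
  independent copies are at most \<open>d\<close> times the moments of a binomial variable. Summing these
  moments against \<open>\<theta>\<^sup>p / p!\<close> yields the scalar Chernoff bound with an additional factor \<open>d\<close>, without
  the Golden-Thompson inequality. Applied to \<open>Y\<close> and to \<open>I - Y\<close>, it controls both ends of the
  spectrum, and the factor \<open>2 d\<close> is absorbed by \<open>n \<ge> c d ln d\<close> unless \<open>d = 1\<close>, where
  \<open>S\<^sub>n = I\<close> almost surely.
\<close>

section \<open>The ring of matrix families\<close>

text \<open>The dimension \<open>d\<close> varies inside the statement, so it cannot be a type. A single type that is
  a unital ring is obtained as the product, over all \<open>d\<close>, of the rings of \<open>d \<times> d\<close> matrices.\<close>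

typedef matfam = "{M :: nat \<Rightarrow> nat \<Rightarrow> nat \<Rightarrow> complex. \<forall>d i j. \<not> (i < d \<and> j < d) \<longrightarrow> M d i j = 0}"
  morphisms ent Abs_matfam
  by (rule exI[of _ "\<lambda>_ _ _. 0"]) simp

setup_lifting type_definition_matfam

lemma ent_outside: "\<not> (i < d \<and> j < d) \<Longrightarrow> ent M d i j = 0"
  using ent[of M] by blast

lemma matfam_eqI: "(\<And>d i j. i < d \<Longrightarrow> j < d \<Longrightarrow> ent M d i j = ent N d i j) \<Longrightarrow> M = N"
  by (metis ent_inject ent_outside ext)

instantiation matfam :: real_algebra_1
begin

lift_definition zero_matfam :: matfam is "\<lambda>d i j. 0" by simp
lift_definition one_matfam :: matfam is "\<lambda>d i j. if i < d \<and> i = j then 1 else 0" by auto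
lift_definition plus_matfam :: "matfam \<Rightarrow> matfam \<Rightarrow> matfam" is "\<lambda>M N d i j. M d i j + N d i j" by auto
lift_definition minus_matfam :: "matfam \<Rightarrow> matfam \<Rightarrow> matfam" is "\<lambda>M N d i j. M d i j - N d i j" by auto
lift_definition uminus_matfam :: "matfam \<Rightarrow> matfam" is "\<lambda>M d i j. - M d i j" by auto
lift_definition scaleR_matfam :: "real \<Rightarrow> matfam \<Rightarrow> matfam" is "\<lambda>c M d i j. c *\<^sub>R M d i j" by auto
lift_definition times_matfam :: "matfam \<Rightarrow> matfam \<Rightarrow> matfam"
  is "\<lambda>M N d i j. \<Sum>l<d. M d i l * N d l j" by (auto intro!: sum.neutral)

instance
proof
  fix a b c :: matfam and r s :: real
  show "a + b + c = a + (b + c)" by transfer (simp add: add.assoc)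
  show "a + b = b + a" by transfer (simp add: add.commute)
  show "0 + a = a" by transfer simp
  show "- a + a = 0" by transfer simp
  show "a - b = a + - b" by transfer simp
  show "r *\<^sub>R (a + b) = r *\<^sub>R a + r *\<^sub>R b" by transfer (simp add: scaleR_right_distrib)
  show "(r + s) *\<^sub>R a = r *\<^sub>R a + s *\<^sub>R a" by transfer (simp add: scaleR_left_distrib)
  show "r *\<^sub>R s *\<^sub>R a = (r * s) *\<^sub>R a" by transfer simp
  show "1 *\<^sub>R a = a" by transfer simp
  show "(a * b) * c = a * (b * c)"
  proof (rule matfam_eqI)
    fix d i j :: nat
    have "ent ((a * b) * c) d i j = (\<Sum>m<d. \<Sum>l<d. ent a d i l * ent b d l m * ent c d m j)"
      by (simp add: times_matfam.rep_eq sum_distrib_right)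
    also have "\<dots> = (\<Sum>l<d. \<Sum>m<d. ent a d i l * ent b d l m * ent c d m j)"
      by (rule sum.swap)
    also have "\<dots> = ent (a * (b * c)) d i j"
      by (simp add: times_matfam.rep_eq sum_distrib_left mult.assoc)
    finally show "ent ((a * b) * c) d i j = ent (a * (b * c)) d i j" .
  qed
  show "1 * a = a"
    by (rule matfam_eqI)
       (simp add: times_matfam.rep_eq one_matfam.rep_eq if_distrib[of "\<lambda>x. x * _"] sum.delta' cong: if_cong)
  show "a * 1 = a"
    by (rule matfam_eqI)
       (auto simp: times_matfam.rep_eq one_matfam.rep_eq if_distrib[of "\<lambda>x. _ * x"] sum.delta cong: if_cong conj_cong)
  show "(a + b) * c = a * c + b * c"
    by transfer (simp add: distrib_right sum.distrib)
  show "a * (b + c) = a * b + a * c"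
    by transfer (simp add: distrib_left sum.distrib)
  show "(0::matfam) \<noteq> 1"
  proof
    assume "(0::matfam) = 1"
    then have "ent 0 1 0 0 = ent 1 1 0 0" by simp
    then show False by (simp add: zero_matfam.rep_eq one_matfam.rep_eq)
  qed
  show "r *\<^sub>R a * b = r *\<^sub>R (a * b)"
    by transfer (simp add: sum_distrib_left scaleR_conv_of_real mult.assoc)
  show "a * r *\<^sub>R b = r *\<^sub>R (a * b)"
    by transfer (simp add: sum_distrib_left scaleR_conv_of_real mult.left_commute)
qed

end

lemmas ent_simps = zero_matfam.rep_eq one_matfam.rep_eq plus_matfam.rep_eq minus_matfam.rep_eq
  uminus_matfam.rep_eq scaleR_matfam.rep_eq times_matfam.rep_eq

lemma ent_sum: "ent (\<Sum>i\<in>I. f i) d k l = (\<Sum>i\<in>I. ent (f i) d k l)"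
  by (induction I rule: infinite_finite_induct) (simp_all add: ent_simps)

lift_definition star :: "matfam \<Rightarrow> matfam" is "\<lambda>M d i j. cnj (M d j i)" by auto

lemma star_star [simp]: "star (star M) = M"
  by transfer simp

lemma star_add [simp]: "star (M + N) = star M + star N"
  by transfer simp

lemma star_diff [simp]: "star (M - N) = star M - star N"
  by transfer simp

lemma star_scaleR [simp]: "star (c *\<^sub>R M) = c *\<^sub>R star M"
  by transfer simp

lemma star_0 [simp]: "star 0 = 0"
  by transfer simp

lemma star_1 [simp]: "star 1 = 1"
  by transfer (auto simp: fun_eq_iff)

lemma star_mult [simp]: "star (M * N) = star N * star M"
  by transfer (simp add: mult.commute)

lemma star_power [simp]: "star (M ^ n) = star M ^ n"
  by (induction n) (simp_all add: power_commutes)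

section \<open>Traces and the cone of positive semidefinite matrices\<close>

definition tr :: "nat \<Rightarrow> matfam \<Rightarrow> real" where
  "tr d M = Re (\<Sum>i<d. ent M d i i)"

lemma tr_add: "tr d (M + N) = tr d M + tr d N"
  by (simp add: tr_def ent_simps sum.distrib)

lemma tr_diff: "tr d (M - N) = tr d M - tr d N"
  by (simp add: tr_def ent_simps sum_subtractf)

lemma tr_scaleR: "tr d (c *\<^sub>R M) = c * tr d M"
  by (simp add: tr_def ent_simps sum_distrib_left)

lemma tr_0 [simp]: "tr d 0 = 0"
  by (simp add: tr_def ent_simps)

lemma tr_1: "tr d 1 = d"
  by (simp add: tr_def ent_simps)

lemma tr_sum: "tr d (\<Sum>i\<in>I. f i) = (\<Sum>i\<in>I. tr d (f i))"
  by (induction I rule: infinite_finite_induct) (simp_all add: tr_add)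

lemma tr_commute: "tr d (M * N) = tr d (N * M)"
proof -
  have "(\<Sum>i<d. \<Sum>l<d. ent M d i l * ent N d l i) = (\<Sum>l<d. \<Sum>i<d. ent N d l i * ent M d i l)"
    by (subst sum.swap) (simp add: mult.commute)
  then show ?thesis by (simp add: tr_def ent_simps)
qed

lemma tr_mult_star_nonneg: "0 \<le> tr d (M * star M)"
  by (auto simp: tr_def ent_simps star.rep_eq complex_mult_cnj intro!: sum_nonneg)

text \<open>Positivity is encoded as the cone generated by the squares \<open>Z * star Z\<close>, in
  all sizes at once. Inequalities then follow by induction over the generators, without eigenvalues
  or a spectral theorem.\<close>

inductive psd :: "matfam \<Rightarrow> bool" where
  psd_square: "psd (Z * star Z)"
| psd_add: "psd M \<Longrightarrow> psd N \<Longrightarrow> psd (M + N)"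

lemma psd_0: "psd 0"
  using psd_square[of 0] by simp

lemma psd_1: "psd 1"
  using psd_square[of 1] by simp

lemma psd_sum: "(\<And>i. i \<in> I \<Longrightarrow> psd (f i)) \<Longrightarrow> psd (\<Sum>i\<in>I. f i)"
  by (induction I rule: infinite_finite_induct) (auto intro: psd_0 psd_add)

lemma psd_star: "psd M \<Longrightarrow> star M = M"
  by (induction rule: psd.induct) auto

lemma psd_conj: "psd M \<Longrightarrow> psd (Z * M * star Z)"
proof (induction rule: psd.induct)
  case (psd_square W)
  then show ?case using psd.psd_square[of "Z * W"] by (simp add: mult.assoc)
next
  case (psd_add M N)
  then show ?case by (simp add: algebra_simps psd.psd_add)
qed

lemma psd_scaleR: "psd M \<Longrightarrow> 0 \<le> c \<Longrightarrow> psd (c *\<^sub>R M)"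
  using psd_conj[of M "sqrt c *\<^sub>R 1"] by simp

text \<open>An even power is a square of a self-adjoint element; an odd power is \<open>H\<close>
  conjugated by \<open>H ^ k\<close>.\<close>

lemma psd_power:
  assumes "psd H"
  shows "psd (H ^ n)"
proof -
  obtain k where "n = k + k \<or> n = Suc (k + k)"
    by (metis add_Suc_right evenE mult_2 oddE Suc_eq_plus1)
  then show ?thesis
    using psd_conj[OF assms, of "H ^ k"] psd_square[of "H ^ k"] psd_star[OF assms]
    by (auto simp: power_add mult.assoc power_commutes)
qed

text \<open>Induction over both cones reduces the claim to generators, where cyclicity turns
  \<open>Z * star Z * (W * star W)\<close> into \<open>V * star V\<close> with
  \<open>V = star W * Z\<close>. The product itself need not be positive; only its trace is.\<close>

lemma tr_psd_mult_nonneg: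
  assumes "psd M" "psd N"
  shows "0 \<le> tr d (M * N)"
  using assms(1)
proof (induction rule: psd.induct)
  case (psd_square Z)
  show ?case using assms(2)
  proof (induction rule: psd.induct)
    case (psd_square W)
    have "tr d (Z * star Z * (W * star W)) = tr d ((star W * Z) * star (star W * Z))"
      using tr_commute[of d "Z * star Z * W" "star W"] by (simp add: mult.assoc)
    then show ?case by (simp add: tr_mult_star_nonneg del: star_mult)
  next
    case (psd_add M N)
    then show ?case by (simp add: distrib_left tr_add)
  qed
next
  case (psd_add M N)
  then show ?case by (simp add: distrib_right tr_add)
qed

lemma tr_psd_nonneg: "psd M \<Longrightarrow> 0 \<le> tr d M"
  using tr_psd_mult_nonneg[OF _ psd_1] by simp

section \<open>Convexity of interlaced traces\<close>

lemma convex_seq_le_max: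
  fixes a :: "nat \<Rightarrow> real"
  assumes "\<And>i. i + 2 \<le> q \<Longrightarrow> 2 * a (i + 1) \<le> a i + a (i + 2)" and "i \<le> q"
  shows "a i \<le> max (a 0) (a q)"
  using assms
proof (induction q arbitrary: i)
  case (Suc q)
  \<comment> \<open>By convexity the increments increase, so the last one dominates all
    others.\<close>
  have inc: "a (j + 1) - a j \<le> a (q + 1) - a q" if "j \<le> q" for j
    using that
  proof (induction rule: inc_induct)
    case (step n)
    have "2 * a (n + 1) \<le> a n + a (n + 2)" using step.hyps by (intro Suc.prems) auto
    then show ?case using step.IH by (simp add: algebra_simps)
  qed simp
  \<comment> \<open>If the last increment is negative, all are, and the sequence falls from
    \<open>a 0\<close> to \<open>a q\<close>.\<close>
  have q: "a q \<le> max (a 0) (a (Suc q))"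
  proof (cases "a (Suc q) < a q")
    case True
    have "a j \<le> a 0" if "j \<le> q" for j
      using that
    proof (induction j)
      case (Suc j)
      then show ?case using inc[of j] True by simp
    qed simp
    then show ?thesis by (simp add: le_max_iff_disj)
  qed auto
  show ?case
  proof (cases "i = Suc q")
    case False
    then have "a i \<le> max (a 0) (a q)" using Suc.prems by (intro Suc.IH) auto
    then show ?thesis using q by auto
  qed auto
qed simp

text \<open>As a function of \<open>i\<close> the left side is convex, and by cyclicity its values
  at \<open>i = 0\<close> and \<open>i = q\<close> both equal the right side.\<close>

lemma tr_interlaced_le:
  assumes H: "psd H" and Y: "star Y = Y" and "i \<le> q"
  shows "tr d (Y * H ^ i * Y * H ^ (q - i)) \<le> tr d (Y * Y * H ^ q)"
proof -
  define a where "a i = tr d (Y * H ^ i * Y * H ^ (q - i))" for i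
  have "2 * a (i + 1) \<le> a i + a (i + 2)" if i: "i + 2 \<le> q" for i
  proof -
    define m where "m = q - i - 2"
    have m: "q - i = m + 2" "q - (i + 1) = m + 1" "q - (i + 2) = m"
      using i by (auto simp: m_def)
    \<comment> \<open>For this commutator, the trace of \<open>star ?Z * H ^ i * ?Z * H ^ m\<close>
      is the second difference of \<open>a\<close> at \<open>i\<close>; it is nonnegative as the
      trace of a product of two positive matrices.\<close>
    let ?Z = "H * Y - Y * H"
    have "psd (star ?Z * H ^ i * star (star ?Z))"
      by (intro psd_conj psd_power H)
    then have "0 \<le> tr d ((star ?Z * H ^ i * ?Z) * H ^ m)"
      using tr_psd_mult_nonneg psd_power[OF H] by simp
    also have "(star ?Z * H ^ i * ?Z) * H ^ m =
        Y * H ^ (i + 2) * Y * H ^ m - Y * H ^ (i + 1) * Y * H ^ (m + 1)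
        - H * (Y * H ^ (i + 1) * Y * H ^ m) + H * (Y * H ^ i * Y * H ^ (m + 1))"
      using psd_star[OF H] Y
      by (simp add: algebra_simps power_commutes power2_eq_square) (simp add: power_commutes flip: mult.assoc)
    also have "tr d \<dots> = a (i + 2) - 2 * a (i + 1) + a i"
      unfolding tr_add tr_diff tr_commute[of d H] a_def m
      by (simp add: mult.assoc power_commutes flip: power_Suc2 power_Suc)
    finally show ?thesis by simp
  qed
  from convex_seq_le_max[of q a, OF this assms(3)] have "a i \<le> max (a 0) (a q)" .
  moreover have "a q = a 0"
    using tr_commute[of d "Y * H ^ q" Y] by (simp add: a_def mult.assoc)
  ultimately show ?thesis by (simp add: a_def)
qed

section \<open>Trace inequality for a bounded positive increment\<close>

text \<open>The ring carries no topology, so differentiation is entrywise; in the end only traces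
  are differentiated.\<close>

definition has_ent_deriv :: "(real \<Rightarrow> matfam) \<Rightarrow> matfam \<Rightarrow> real \<Rightarrow> bool" where
  "has_ent_deriv F F' t \<longleftrightarrow>
     (\<forall>d i j. ((\<lambda>t. ent (F t) d i j) has_vector_derivative ent F' d i j) (at t))"

lemma has_ent_deriv_const: "has_ent_deriv (\<lambda>t. A) 0 t"
  by (simp add: has_ent_deriv_def ent_simps)

lemma has_ent_deriv_line: "has_ent_deriv (\<lambda>t. A + t *\<^sub>R Y) Y t"
  unfolding has_ent_deriv_def ent_simps
  by (auto intro!: derivative_eq_intros)

lemma has_ent_deriv_mult:
  assumes "has_ent_deriv F F' t" "has_ent_deriv G G' t"
  shows "has_ent_deriv (\<lambda>t. F t * G t) (F' * G t + F t * G') t"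
  unfolding has_ent_deriv_def
proof (intro allI)
  fix d i j
  have "((\<lambda>t. \<Sum>l<d. ent (F t) d i l * ent (G t) d l j) has_vector_derivative
      (\<Sum>l<d. ent (F t) d i l * ent G' d l j + ent F' d i l * ent (G t) d l j)) (at t)"
    using assms unfolding has_ent_deriv_def
    by (intro has_vector_derivative_sum has_vector_derivative_mult) blast+
  then show "((\<lambda>t. ent (F t * G t) d i j) has_vector_derivative
      ent (F' * G t + F t * G') d i j) (at t)"
    by (simp add: ent_simps sum.distrib add.commute)
qed

lemma has_ent_deriv_power:
  assumes "has_ent_deriv H Y t"
  shows "has_ent_deriv (\<lambda>t. H t ^ q) (\<Sum>i<q. H t ^ i * Y * H t ^ (q - Suc i)) t"
proof (induction q)
  case 0
  show ?case using has_ent_deriv_const by simp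
next
  case (Suc q)
  have "(\<Sum>i<Suc q. H t ^ i * Y * H t ^ (Suc q - Suc i)) =
      Y * H t ^ q + H t * (\<Sum>i<q. H t ^ i * Y * H t ^ (q - Suc i))"
    by (simp add: sum.lessThan_Suc_shift sum_distrib_left mult.assoc del: sum.lessThan_Suc)
  then show ?case using has_ent_deriv_mult[OF assms Suc.IH] by simp
qed

lemma tr_has_real_derivative:
  assumes "has_ent_deriv F F' t"
  shows "((\<lambda>t. tr d (F t)) has_real_derivative tr d F') (at t)"
  using assms unfolding has_ent_deriv_def tr_def has_real_derivative_iff_has_vector_derivative
  by (intro bounded_linear.has_vector_derivative[OF bounded_linear_Re] has_vector_derivative_sum) auto

lemma tr_mult_power_deriv:
  "((\<lambda>t. tr d (B * (A + t *\<^sub>R Y) ^ q)) has_real_derivative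
     (\<Sum>i<q. tr d (B * (A + t *\<^sub>R Y) ^ i * Y * (A + t *\<^sub>R Y) ^ (q - Suc i)))) (at t)"
proof -
  have "has_ent_deriv (\<lambda>t. B * (A + t *\<^sub>R Y) ^ q)
      (0 * (A + t *\<^sub>R Y) ^ q + B * (\<Sum>i<q. (A + t *\<^sub>R Y) ^ i * Y * (A + t *\<^sub>R Y) ^ (q - Suc i))) t"
    by (intro has_ent_deriv_mult has_ent_deriv_const has_ent_deriv_power has_ent_deriv_line)
  from tr_has_real_derivative[OF this, of d] show ?thesis
    by (simp add: sum_distrib_left tr_sum mult.assoc)
qed

text \<open>In the noncommutative product rule the inserted factor is now \<open>1\<close>, so the
  \<open>q\<close> terms coincide.\<close>

lemma tr_mult_power_shift_deriv:
  "((\<lambda>t. tr d (B * (A + t *\<^sub>R 1) ^ q)) has_real_derivative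
     real q * tr d (B * (A + t *\<^sub>R 1) ^ (q - 1))) (at t)"
proof -
  have "(\<Sum>i<q. tr d (B * (A + t *\<^sub>R 1) ^ i * 1 * (A + t *\<^sub>R 1) ^ (q - Suc i))) =
      (\<Sum>i<q. tr d (B * (A + t *\<^sub>R 1) ^ (q - 1)))"
    by (intro sum.cong refl) (simp add: mult.assoc flip: power_add)
  then show ?thesis using tr_mult_power_deriv[of d B A 1 q t] by simp
qed

text \<open>The operator interval between 0 and 1; the name is the one used in quantum
  theory.\<close>

definition effect :: "matfam \<Rightarrow> bool" where
  "effect Y \<longleftrightarrow> psd Y \<and> psd (1 - Y)"

text \<open>Since the summands \<open>Y\<close> and \<open>1 - Y\<close> add up to 1,
  \<open>Y (1 - Y) = Y (1 - Y) Y + (1 - Y) Y (1 - Y)\<close>.\<close>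

lemma effect_square:
  assumes "effect Y"
  shows "psd (Y - Y * Y)"
proof -
  have Y: "star Y = Y" using assms psd_star by (auto simp: effect_def)
  have "Y - Y * Y = Y * (1 - Y) * star Y + (1 - Y) * Y * star (1 - Y)"
    using Y by (simp add: algebra_simps)
  moreover have "psd \<dots>"
    using assms unfolding effect_def by (intro psd_add psd_conj) auto
  ultimately show ?thesis by simp
qed

text \<open>Both sides are compared as functions of the coupling \<open>t\<close>: by
  \<open>tr_interlaced_le\<close> and \<open>Y\<^sup>2 \<le> Y\<close>, the derivative of the left hand side
  is at most \<open>q\<close> times the left hand side for \<open>q - 1\<close>, while on the right there is equality.\<close>

lemma tr_effect_power_le:
  assumes A: "psd A" and Y: "effect Y" and "0 \<le> t"
  shows "tr d (Y * (A + t *\<^sub>R Y) ^ q) \<le> tr d (Y * (A + t *\<^sub>R 1) ^ q)"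
  using \<open>0 \<le> t\<close>
proof (induction q arbitrary: t)
  case 0
  then show ?case by simp
next
  case (Suc q)
  define f where "f t = tr d (Y * (A + t *\<^sub>R 1) ^ Suc q) - tr d (Y * (A + t *\<^sub>R Y) ^ Suc q)" for t
  have "\<exists>D. (f has_real_derivative D) (at s) \<and> 0 \<le> D" if s: "0 \<le> s" "s \<le> t" for s
  proof -
    let ?H = "A + s *\<^sub>R Y"
    have H: "psd ?H" using A Y s by (auto simp: effect_def intro!: psd_add psd_scaleR)
    have sY: "star Y = Y" using Y psd_star by (auto simp: effect_def)
    let ?D = "real (Suc q) * tr d (Y * (A + s *\<^sub>R 1) ^ q)
      - (\<Sum>i<Suc q. tr d (Y * ?H ^ i * Y * ?H ^ (Suc q - Suc i)))"
    have "(f has_real_derivative ?D) (at s)"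
      unfolding f_def using tr_mult_power_shift_deriv[of d Y A "Suc q" s]
      by (intro DERIV_diff tr_mult_power_deriv) (simp del: power_Suc)
    moreover have "tr d (Y * ?H ^ i * Y * ?H ^ (Suc q - Suc i)) \<le> tr d (Y * (A + s *\<^sub>R 1) ^ q)"
      if "i < Suc q" for i
    proof -
      have "tr d (Y * ?H ^ i * Y * ?H ^ (q - i)) \<le> tr d (Y * Y * ?H ^ q)"
        using that by (intro tr_interlaced_le H sY) auto
      also have "\<dots> \<le> tr d (Y * ?H ^ q)"
        using tr_psd_mult_nonneg[OF effect_square[OF Y] psd_power[OF H], of d q]
        by (simp add: left_diff_distrib tr_diff)
      also have "\<dots> \<le> tr d (Y * (A + s *\<^sub>R 1) ^ q)" using Suc.IH s by simp
      finally show ?thesis by simp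
    qed
    then have "(\<Sum>i<Suc q. tr d (Y * ?H ^ i * Y * ?H ^ (Suc q - Suc i)))
        \<le> real (Suc q) * tr d (Y * (A + s *\<^sub>R 1) ^ q)"
      using sum_bounded_above[of "{..<Suc q}"
          "\<lambda>i. tr d (Y * ?H ^ i * Y * ?H ^ (Suc q - Suc i))" "tr d (Y * (A + s *\<^sub>R 1) ^ q)"]
      by (simp del: sum.lessThan_Suc)
    ultimately show ?thesis by (intro exI[of _ ?D]) auto
  qed
  then have "f 0 \<le> f t" by (intro DERIV_nonneg_imp_nondecreasing[of 0 t f] Suc.prems) auto
  then show ?case by (simp add: f_def)
qed

text \<open>By cyclicity the trace of \<open>(A + t *\<^sub>R Y) ^ p\<close> has derivative
  \<open>p\<close> times that of \<open>Y * (A + t *\<^sub>R Y) ^ (p - 1)\<close>. The preceding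
  lemma bounds this by the derivative of the trace of \<open>Y * (A + t *\<^sub>R 1) ^ p\<close>,
  and \<open>t\<close> runs from 0 to 1. The gain is that \<open>Y\<close> enters the bound only
  linearly.\<close>

lemma tr_power_add_effect_le:
  assumes A: "psd A" and Y: "effect Y"
  shows "tr d ((A + Y) ^ p) \<le> tr d (A ^ p) + tr d (Y * ((A + 1) ^ p - A ^ p))"
proof -
  define f where "f t = tr d (Y * (A + t *\<^sub>R 1) ^ p) - tr d ((A + t *\<^sub>R Y) ^ p)" for t
  have "\<exists>D. (f has_real_derivative D) (at s) \<and> 0 \<le> D" if s: "0 \<le> s" "s \<le> 1" for s
  proof -
    let ?H = "A + s *\<^sub>R Y"
    let ?D = "real p * tr d (Y * (A + s *\<^sub>R 1) ^ (p - 1))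
      - (\<Sum>i<p. tr d (1 * ?H ^ i * Y * ?H ^ (p - Suc i)))"
    have "(f has_real_derivative ?D) (at s)"
      unfolding f_def using tr_mult_power_deriv[of d 1 A Y p s]
      by (intro DERIV_diff tr_mult_power_shift_deriv) (simp only: mult_1)
    moreover have "(\<Sum>i<p. tr d (1 * ?H ^ i * Y * ?H ^ (p - Suc i))) =
        (\<Sum>i<p. tr d (Y * ?H ^ (p - 1)))"
    proof (intro sum.cong refl)
      fix i assume "i \<in> {..<p}"
      then have "p - Suc i + i = p - 1" by simp
      then have "?H ^ (p - Suc i) * ?H ^ i = ?H ^ (p - 1)"
        by (metis power_add)
      then show "tr d (1 * ?H ^ i * Y * ?H ^ (p - Suc i)) = tr d (Y * ?H ^ (p - 1))"
        using tr_commute[of d "?H ^ i" "Y * ?H ^ (p - Suc i)"] by (metis mult.assoc mult_1)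
    qed
    moreover have "tr d (Y * ?H ^ (p - 1)) \<le> tr d (Y * (A + s *\<^sub>R 1) ^ (p - 1))"
      by (intro tr_effect_power_le A Y s)
    ultimately show ?thesis
      by (intro exI[of _ ?D] conjI) (simp_all only: sum_constant card_lessThan, simp add: mult_left_mono)
  qed
  then have "f 0 \<le> f 1" by (intro DERIV_nonneg_imp_nondecreasing[of 0 1 f]) auto
  then show ?thesis by (simp add: f_def right_diff_distrib tr_diff)
qed

text \<open>The moment \<open>E (b + X)\<^sup>p\<close> of a binomial variable \<open>X\<close> with parameters \<open>n\<close> and \<open>\<mu>\<close>.\<close>

primrec binmom :: "real \<Rightarrow> nat \<Rightarrow> real \<Rightarrow> nat \<Rightarrow> real" where
  "binmom \<mu> 0 b p = b ^ p"
| "binmom \<mu> (Suc n) b p = (1 - \<mu>) * binmom \<mu> n b p + \<mu> * binmom \<mu> n (b + 1) p"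

lemma binmom_nonneg: "0 \<le> \<mu> \<Longrightarrow> \<mu> \<le> 1 \<Longrightarrow> 0 \<le> b \<Longrightarrow> 0 \<le> binmom \<mu> n b p"
  by (induction n arbitrary: b) auto

text \<open>This is the moment generating function of the shifted binomial variable. In the
  induction the shift from \<open>b\<close> to \<open>b + 1\<close> contributes the factor
  \<open>exp \<theta>\<close>.\<close>

lemma binmom_exp_sums:
  "(\<lambda>p. \<theta> ^ p / fact p * binmom \<mu> n b p) sums (exp (\<theta> * b) * (1 - \<mu> + \<mu> * exp \<theta>) ^ n)"
proof (induction n arbitrary: b)
  case 0
  show ?case using exp_converges[of "\<theta> * b"]
    by (simp add: power_mult_distrib divide_simps scaleR_conv_of_real mult.commute)
next
  case (Suc n)
  from sums_add[OF sums_mult[OF Suc.IH[of b], of "1 - \<mu>"] sums_mult[OF Suc.IH[of "b + 1"], of \<mu>]]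
  show ?case by (simp add: distrib_left distrib_right exp_add mult_ac)
qed

section \<open>Trace moments of sums of independent matrices\<close>

lemma borel_measurable_ent_power:
  assumes "\<And>i j. (\<lambda>x. ent (F x) d i j) \<in> borel_measurable M"
  shows "(\<lambda>x. ent (F x ^ p) d i j) \<in> borel_measurable M"
proof (induction p arbitrary: i j)
  case (Suc p)
  then show ?case using assms by (simp add: ent_simps)
qed (simp add: ent_simps)

lemma borel_measurable_tr:
  assumes "\<And>i j. (\<lambda>x. ent (F x) d i j) \<in> borel_measurable M"
  shows "(\<lambda>x. tr d (F x)) \<in> borel_measurable M"
  unfolding tr_def by (intro measurable_compose[OF _ borel_measurable_Re] borel_measurable_sum assms)

lemma tr_mult_mean:
  assumes "\<And>i j. integrable D (\<lambda>x. ent (Y x) d i j)"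
    and "\<And>i j. i < d \<Longrightarrow> j < d \<Longrightarrow> (\<integral>x. ent (Y x) d i j \<partial>D) = (if i = j then of_real \<mu> else 0)"
  shows "integrable D (\<lambda>x. tr d (Y x * B))" "(\<integral>x. tr d (Y x * B) \<partial>D) = \<mu> * tr d B"
proof -
  have int: "integrable D (\<lambda>x. \<Sum>i<d. \<Sum>l<d. ent (Y x) d i l * ent B d l i)"
    by (intro Bochner_Integration.integrable_sum integrable_mult_left assms)
  have eq: "(\<lambda>x. tr d (Y x * B)) = (\<lambda>x. Re (\<Sum>i<d. \<Sum>l<d. ent (Y x) d i l * ent B d l i))"
    by (simp add: tr_def ent_simps fun_eq_iff)
  show "integrable D (\<lambda>x. tr d (Y x * B))"
    unfolding eq using int by (rule integrable_Re)
  have "(\<integral>x. (\<Sum>i<d. \<Sum>l<d. ent (Y x) d i l * ent B d l i) \<partial>D) =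
      (\<Sum>i<d. \<Sum>l<d. (\<integral>x. ent (Y x) d i l \<partial>D) * ent B d l i)"
    using assms(1) by (subst Bochner_Integration.integral_sum;
      (intro Bochner_Integration.integrable_sum integrable_mult_left assms sum.cong refl)?)
      (subst Bochner_Integration.integral_sum;
      (intro Bochner_Integration.integrable_sum integrable_mult_left assms sum.cong refl)?; simp)
  also have "\<dots> = (\<Sum>i<d. of_real \<mu> * ent B d i i)"
    by (intro sum.cong refl)
       (simp add: assms(2) if_distrib[of "\<lambda>x. x * _"] cong: if_cong)
  finally show "(\<integral>x. tr d (Y x * B) \<partial>D) = \<mu> * tr d B"
    unfolding eq integral_Re[OF int] by (simp add: tr_def sum_distrib_left)
qed

text \<open>The trace inequality is linear in \<open>Y\<close>, so after averaging only the mean of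
  \<open>Y\<close> matters, and the result is what a Bernoulli variable in place of \<open>Y\<close>
  would give. The nonnegative integral on the left spares the integrability of the power.\<close>

lemma nn_integral_tr_power_add_effect_le:
  assumes "prob_space D" "\<And>x. effect (Y x)" "psd A"
    and "\<And>i j. integrable D (\<lambda>x. ent (Y x) d i j)"
    and "\<And>i j. i < d \<Longrightarrow> j < d \<Longrightarrow> (\<integral>x. ent (Y x) d i j \<partial>D) = (if i = j then of_real \<mu> else 0)"
  shows "(\<integral>\<^sup>+x. ennreal (tr d ((A + Y x) ^ p)) \<partial>D)
    \<le> ennreal ((1 - \<mu>) * tr d (A ^ p) + \<mu> * tr d ((A + 1) ^ p))"
proof -
  interpret prob_space D by fact
  let ?B = "(A + 1) ^ p - A ^ p"
  have le: "tr d ((A + Y x) ^ p) \<le> tr d (A ^ p) + tr d (Y x * ?B)" for x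
    by (rule tr_power_add_effect_le) fact+
  have "0 \<le> tr d ((A + Y x) ^ p)" for x
    using assms(2)[of x] assms(3) by (intro tr_psd_nonneg psd_power psd_add) (auto simp: effect_def)
  then have nonneg: "0 \<le> tr d (A ^ p) + tr d (Y x * ?B)" for x
    using le by (rule order_trans)
  have "(\<integral>\<^sup>+x. ennreal (tr d ((A + Y x) ^ p)) \<partial>D) \<le> (\<integral>\<^sup>+x. ennreal (tr d (A ^ p) + tr d (Y x * ?B)) \<partial>D)"
    by (intro nn_integral_mono ennreal_leI le)
  also have "\<dots> = ennreal (\<integral>x. tr d (A ^ p) + tr d (Y x * ?B) \<partial>D)"
    using nonneg tr_mult_mean(1)[OF assms(4,5)] by (intro nn_integral_eq_integral) auto
  also have "(\<integral>x. tr d (A ^ p) + tr d (Y x * ?B) \<partial>D) = (1 - \<mu>) * tr d (A ^ p) + \<mu> * tr d ((A + 1) ^ p)"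
  proof -
    have "(\<integral>x. tr d (A ^ p) + tr d (Y x * ?B) \<partial>D) = tr d (A ^ p) + \<mu> * tr d ?B"
      using tr_mult_mean[OF assms(4,5), of ?B] by (simp add: prob_space)
    then show ?thesis by (simp add: tr_diff algebra_simps)
  qed
  finally show ?thesis .
qed

text \<open>The last copy is integrated out with the other copies frozen in the role of
  \<open>A\<close>. The resulting term either keeps the offset or raises it by 1, as in
  \<open>binmom\<close>, hence the induction over all \<open>b\<close>.\<close>

lemma nn_integral_tr_power_sum_le:
  assumes D: "prob_space D" and Y: "\<And>x. effect (Y x)" and \<mu>: "0 \<le> \<mu>" "\<mu> \<le> 1"
    and int: "\<And>i j. integrable D (\<lambda>x. ent (Y x) d i j)"
    and mean: "\<And>i j. i < d \<Longrightarrow> j < d \<Longrightarrow> (\<integral>x. ent (Y x) d i j \<partial>D) = (if i = j then of_real \<mu> else 0)"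
    and "0 \<le> b"
  shows "(\<integral>\<^sup>+T. ennreal (tr d ((b *\<^sub>R 1 + (\<Sum>j<n. Y (T j))) ^ p)) \<partial>PiM {..<n} (\<lambda>_. D))
    \<le> ennreal (d * binmom \<mu> n b p)"
  using \<open>0 \<le> b\<close>
proof (induction n arbitrary: b)
  case 0
  interpret product_prob_space "\<lambda>_. D" by (simp add: D product_prob_spaceI)
  have "(b *\<^sub>R 1 :: matfam) ^ p = b ^ p *\<^sub>R 1"
    by (induction p) simp_all
  then show ?case by (simp add: PiM_empty tr_scaleR tr_1 mult.commute)
next
  case (Suc n)
  interpret product_prob_space "\<lambda>_. D" by (simp add: D product_prob_spaceI)
  have psd_b: "psd (b *\<^sub>R 1 + (\<Sum>j<n. Y (T j)))" if "0 \<le> b" for b n T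
    using Y that by (intro psd_add psd_scaleR psd_1 psd_sum) (auto simp: effect_def)
  have meas: "(\<lambda>T. ennreal (tr d ((b *\<^sub>R 1 + (\<Sum>j<n. Y (T j))) ^ p))) \<in> borel_measurable (PiM {..<n} (\<lambda>_. D))" for b n
  proof (intro measurable_compose[OF _ measurable_ennreal] borel_measurable_tr borel_measurable_ent_power)
    fix k l
    have "(\<lambda>T. ent (Y (T j)) d k l) \<in> borel_measurable (PiM {..<n} (\<lambda>_. D))" if "j < n" for j
      using that borel_measurable_integrable[OF int]
      by (intro measurable_compose[OF measurable_component_singleton]) auto
    then show "(\<lambda>T. ent (b *\<^sub>R 1 + (\<Sum>j<n. Y (T j))) d k l) \<in> borel_measurable (PiM {..<n} (\<lambda>_. D))"
      by (simp add: ent_simps ent_sum)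
  qed
  have "(\<integral>\<^sup>+T. ennreal (tr d ((b *\<^sub>R 1 + (\<Sum>j<Suc n. Y (T j))) ^ p)) \<partial>PiM {..<Suc n} (\<lambda>_. D))
      = (\<integral>\<^sup>+T. (\<integral>\<^sup>+x. ennreal (tr d ((b *\<^sub>R 1 + (\<Sum>j<Suc n. Y ((T(n := x)) j))) ^ p)) \<partial>D) \<partial>PiM {..<n} (\<lambda>_. D))"
    using meas[of b "Suc n"] unfolding lessThan_Suc by (intro product_nn_integral_insert) auto
  also have "\<dots> = (\<integral>\<^sup>+T. (\<integral>\<^sup>+x. ennreal (tr d (((b *\<^sub>R 1 + (\<Sum>j<n. Y (T j))) + Y x) ^ p)) \<partial>D) \<partial>PiM {..<n} (\<lambda>_. D))"
    by (simp add: add.assoc)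
  also have "\<dots> \<le> (\<integral>\<^sup>+T. ennreal ((1 - \<mu>) * tr d ((b *\<^sub>R 1 + (\<Sum>j<n. Y (T j))) ^ p)
      + \<mu> * tr d (((b *\<^sub>R 1 + (\<Sum>j<n. Y (T j))) + 1) ^ p)) \<partial>PiM {..<n} (\<lambda>_. D))"
    by (intro nn_integral_mono nn_integral_tr_power_add_effect_le D Y int mean psd_b Suc.prems)
  also have "\<dots> = (\<integral>\<^sup>+T. ennreal (1 - \<mu>) * ennreal (tr d ((b *\<^sub>R 1 + (\<Sum>j<n. Y (T j))) ^ p))
      + ennreal \<mu> * ennreal (tr d (((b + 1) *\<^sub>R 1 + (\<Sum>j<n. Y (T j))) ^ p)) \<partial>PiM {..<n} (\<lambda>_. D))"
  proof (intro nn_integral_cong)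
    fix T
    have nonneg: "0 \<le> tr d ((b *\<^sub>R 1 + (\<Sum>j<n. Y (T j))) ^ p)" "0 \<le> tr d (((b + 1) *\<^sub>R 1 + (\<Sum>j<n. Y (T j))) ^ p)"
      using Suc.prems by (intro tr_psd_nonneg psd_power psd_b; simp)+
    have shift: "(b *\<^sub>R 1 + (\<Sum>j<n. Y (T j))) + 1 = (b + 1) *\<^sub>R 1 + (\<Sum>j<n. Y (T j))"
      by (simp add: scaleR_left_distrib)
    show "ennreal ((1 - \<mu>) * tr d ((b *\<^sub>R 1 + (\<Sum>j<n. Y (T j))) ^ p)
          + \<mu> * tr d (((b *\<^sub>R 1 + (\<Sum>j<n. Y (T j))) + 1) ^ p))
        = ennreal (1 - \<mu>) * ennreal (tr d ((b *\<^sub>R 1 + (\<Sum>j<n. Y (T j))) ^ p))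
          + ennreal \<mu> * ennreal (tr d (((b + 1) *\<^sub>R 1 + (\<Sum>j<n. Y (T j))) ^ p))"
      unfolding shift using \<mu> nonneg by (simp add: ennreal_plus ennreal_mult)
  qed
  also have "\<dots> = ennreal (1 - \<mu>) * (\<integral>\<^sup>+T. ennreal (tr d ((b *\<^sub>R 1 + (\<Sum>j<n. Y (T j))) ^ p)) \<partial>PiM {..<n} (\<lambda>_. D))
      + ennreal \<mu> * (\<integral>\<^sup>+T. ennreal (tr d (((b + 1) *\<^sub>R 1 + (\<Sum>j<n. Y (T j))) ^ p)) \<partial>PiM {..<n} (\<lambda>_. D))"
    by (subst nn_integral_add, (intro borel_measurable_times_ennreal borel_measurable_const meas)+)
       (simp only: nn_integral_cmult[OF meas])
  also have "\<dots> \<le> ennreal (1 - \<mu>) * ennreal (d * binmom \<mu> n b p) + ennreal \<mu> * ennreal (d * binmom \<mu> n (b + 1) p)"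
    using Suc.prems by (intro add_mono mult_left_mono Suc.IH) auto
  also have "\<dots> = ennreal (d * binmom \<mu> (Suc n) b p)"
  proof -
    let ?u = "(1 - \<mu>) * (d * binmom \<mu> n b p)" and ?v = "\<mu> * (d * binmom \<mu> n (b + 1) p)"
    have "0 \<le> ?u" "0 \<le> ?v"
      using \<mu> Suc.prems by (auto intro!: mult_nonneg_nonneg binmom_nonneg)
    moreover have "?u + ?v = d * binmom \<mu> (Suc n) b p"
      by (simp add: algebra_simps)
    ultimately show ?thesis
      using \<mu> ennreal_plus[of ?u ?v] by (simp only: ennreal_mult' diff_ge_0_iff_ge)
  qed
  finally show ?case .
qed

text \<open>The event \<open>E\<close> stands in for "some eigenvalue is at least \<open>a\<close>",
  which forces all its inequalities. Since one event serves every \<open>p\<close>, Markov's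
  inequality for all moments can be summed into an exponential bound.\<close>

lemma trace_moment_tail:
  fixes n :: nat
  assumes D: "prob_space D" and Y: "\<And>x. effect (Y x)" and \<mu>: "0 \<le> \<mu>" "\<mu> \<le> 1"
    and int: "\<And>i j. integrable D (\<lambda>x. ent (Y x) d i j)"
    and mean: "\<And>i j. i < d \<Longrightarrow> j < d \<Longrightarrow> (\<integral>x. ent (Y x) d i j \<partial>D) = (if i = j then of_real \<mu> else 0)"
    and "0 \<le> \<theta>" "0 \<le> a"
  defines "P \<equiv> PiM {..<n} (\<lambda>_. D)"
  defines "E \<equiv> {T \<in> space P. \<forall>p. a ^ p \<le> tr d ((\<Sum>j<n. Y (T j)) ^ p)}"
  shows "E \<in> sets P" "measure P E \<le> d * exp (- \<theta> * a) * (1 - \<mu> + \<mu> * exp \<theta>) ^ n"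
proof -
  interpret D: product_prob_space "\<lambda>_. D" by (simp add: D product_prob_spaceI)
  interpret P: prob_space P unfolding P_def by (intro prob_space_PiM D)
  have meas: "(\<lambda>T. tr d ((\<Sum>j<n. Y (T j)) ^ p)) \<in> borel_measurable P" for p
  proof (intro borel_measurable_tr borel_measurable_ent_power)
    fix k l
    have "(\<lambda>T. ent (Y (T j)) d k l) \<in> borel_measurable P" if "j < n" for j
      using that borel_measurable_integrable[OF int] unfolding P_def
      by (intro measurable_compose[OF measurable_component_singleton]) auto
    then show "(\<lambda>T. ent (\<Sum>j<n. Y (T j)) d k l) \<in> borel_measurable P"
      by (simp add: ent_sum)
  qed
  show E: "E \<in> sets P" unfolding E_def using meas by measurable
  \<comment> \<open>Markov's inequality for the moment of order \<open>p\<close>.\<close>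
  have moment: "measure P E * a ^ p \<le> d * binmom \<mu> n 0 p" for p
  proof -
    have "ennreal (measure P E * a ^ p) = (\<integral>\<^sup>+T. ennreal (a ^ p) * indicator E T \<partial>P)"
      using E \<open>0 \<le> a\<close>
      by (subst nn_integral_cmult_indicator[OF E])
         (simp add: P.emeasure_eq_measure mult.commute flip: ennreal_mult')
    also have "\<dots> \<le> (\<integral>\<^sup>+T. ennreal (tr d ((0 *\<^sub>R 1 + (\<Sum>j<n. Y (T j))) ^ p)) \<partial>P)"
      by (intro nn_integral_mono) (auto simp: E_def indicator_def intro!: ennreal_leI)
    also have "\<dots> \<le> ennreal (d * binmom \<mu> n 0 p)"
      unfolding P_def by (intro nn_integral_tr_power_sum_le D Y \<mu> int mean) auto
    finally show ?thesis
      using \<mu> by (subst (asm) ennreal_le_iff) (auto intro!: mult_nonneg_nonneg binmom_nonneg)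
  qed
  \<comment> \<open>Weighting the moment bounds by \<open>\<theta> ^ p / fact p\<close> and summing
    gives exponentials on both sides.\<close>
  have "(\<lambda>p. measure P E * (\<theta> ^ p / fact p * a ^ p)) sums (measure P E * exp (\<theta> * a))"
    using exp_converges[of "\<theta> * a"]
    by (intro sums_mult) (simp add: power_mult_distrib scaleR_conv_of_real divide_simps mult.commute)
  moreover have "(\<lambda>p. d * (\<theta> ^ p / fact p * binmom \<mu> n 0 p)) sums (d * (1 - \<mu> + \<mu> * exp \<theta>) ^ n)"
    using sums_mult[OF binmom_exp_sums[of \<theta> \<mu> n 0], of d] by simp
  moreover have "measure P E * (\<theta> ^ p / fact p * a ^ p) \<le> d * (\<theta> ^ p / fact p * binmom \<mu> n 0 p)" for p
    using mult_left_mono[OF moment[of p], of "\<theta> ^ p / fact p"] \<open>0 \<le> \<theta>\<close> by (simp add: mult_ac)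
  ultimately have "measure P E * exp (\<theta> * a) \<le> d * (1 - \<mu> + \<mu> * exp \<theta>) ^ n"
    by (rule sums_le[rotated])
  then show "measure P E \<le> d * exp (- \<theta> * a) * (1 - \<mu> + \<mu> * exp \<theta>) ^ n"
    by (simp add: exp_minus field_simps)
qed

section \<open>Rank-one matrices and quadratic forms\<close>

text \<open>A matrix of size \<open>d\<close> is embedded into the family by zero in all other sizes.\<close>

lift_definition column :: "nat \<Rightarrow> (nat \<Rightarrow> complex) \<Rightarrow> matfam"
  is "\<lambda>d x d' i j. if d' = d \<and> i < d \<and> j = 0 then x i else 0" by auto

lift_definition unit_at :: "nat \<Rightarrow> matfam"
  is "\<lambda>d d' i j. if d' = d \<and> i < d \<and> i = j then 1 else 0" by auto

text \<open>The vector sits in column 0 of a square matrix, so that its rank-one matrix is literally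
  a generator of the cone \<open>psd\<close>.\<close>

definition outer :: "nat \<Rightarrow> (nat \<Rightarrow> complex) \<Rightarrow> matfam" where
  "outer d x = column d x * star (column d x)"

lemma ent_outer:
  assumes "i < d'" "j < d'"
  shows "ent (outer d x) d' i j = (if d' = d then x i * cnj (x j) else 0)"
proof -
  have "ent (outer d x) d' i j = (\<Sum>l<d'. if l = 0 then ent (column d x) d' i 0 * cnj (ent (column d x) d' j 0) else 0)"
    unfolding outer_def ent_simps star.rep_eq by (rule sum.cong) (auto simp: column.rep_eq)
  also have "\<dots> = (if d' = d then x i * cnj (x j) else 0)"
    using assms by (subst sum.delta) (auto simp: column.rep_eq)
  finally show ?thesis .
qed

lemma psd_outer: "psd (outer d x)"
  by (simp add: outer_def psd_square)

lemma vnorm_nonneg: "0 \<le> vnorm d x"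
  by (simp add: vnorm_def sum_nonneg)

lemma vnorm_power2: "(vnorm d x)\<^sup>2 = (\<Sum>i<d. (cmod (x i))\<^sup>2)"
  by (simp add: vnorm_def sum_nonneg)

lemma vnorm_scaleR: "vnorm d (\<lambda>i. complex_of_real c * x i) = \<bar>c\<bar> * vnorm d x"
  by (simp add: vnorm_def norm_mult power_mult_distrib real_sqrt_mult flip: sum_distrib_left)

lemma tr_outer: "tr d (outer d x) = (vnorm d x)\<^sup>2"
proof -
  have "tr d (outer d x) = Re (\<Sum>i<d. complex_of_real ((cmod (x i))\<^sup>2))"
    unfolding tr_def by (intro arg_cong[of _ _ Re] sum.cong refl)
      (simp only: lessThan_iff ent_outer if_True simp_thms complex_norm_square)
  then show ?thesis by (simp add: vnorm_power2)
qed

lemma outer_scaleR: "outer d (\<lambda>i. complex_of_real c * x i) = c\<^sup>2 *\<^sub>R outer d x"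
  by (intro matfam_eqI) (simp add: ent_simps ent_outer scaleR_conv_of_real[where 'a=complex] power2_eq_square)

text \<open>Conjugation maps rank-one matrices to rank-one matrices, so bounds on quadratic forms
  can be applied at the image vector. In sizes other than \<open>d\<close> both sides
  vanish.\<close>

lemma conj_outer:
  "Z * outer d x * star Z = outer d (\<lambda>i. \<Sum>l<d. ent Z d i l * x l)" (is "?L = ?R")
proof (rule matfam_eqI)
  fix d' i j :: nat assume ij: "i < d'" "j < d'"
  show "ent ?L d' i j = ent ?R d' i j"
  proof (cases "d' = d")
    case True
    have "ent ?L d' i j = (\<Sum>m<d. (\<Sum>l<d. ent Z d i l * (x l * cnj (x m))) * cnj (ent Z d j m))"
      using True by (simp add: ent_simps star.rep_eq ent_outer)
    also have "\<dots> = (\<Sum>l<d. ent Z d i l * x l) * cnj (\<Sum>m<d. ent Z d j m * x m)"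
      by (simp add: sum_distrib_left sum_distrib_right mult_ac)
    finally show ?thesis using ij True by (simp add: ent_outer)
  next
    case False
    then show ?thesis using ij by (simp add: ent_simps star.rep_eq ent_outer)
  qed
qed

text \<open>Lagrange's identity \<open>|x|\<^sup>2 |y|\<^sup>2 - |\<langle>x, y\<rangle>|\<^sup>2 = 1/2 \<Sum>\<^sub>i\<^sub>j |x\<^sub>i y\<^sub>j - x\<^sub>j y\<^sub>i|\<^sup>2\<close>,
  written as an identity of quadratic forms in \<open>y\<close>.\<close>

lemma lagrange_outer:
  "(vnorm d x)\<^sup>2 *\<^sub>R unit_at d - outer d x =
    (1/2) *\<^sub>R (\<Sum>i<d. \<Sum>j<d. outer d (\<lambda>m. cnj (x i) * of_bool (m = j) - cnj (x j) * of_bool (m = i)))"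
  (is "?L = ?R")
proof (rule matfam_eqI)
  fix d' a b :: nat assume ab: "a < d'" "b < d'"
  show "ent ?L d' a b = ent ?R d' a b"
  proof (cases "d' = d")
    case True
    have [simp]: "cnj (of_bool Q) = of_bool Q" for Q by (simp add: of_bool_def)
    have eq: "ent ?R d' a b = (1/2) * (\<Sum>i<d. \<Sum>j<d.
       cnj (x i) * x i * (of_bool (a = j) * of_bool (b = j))
       - cnj (x i) * x j * (of_bool (a = j) * of_bool (b = i))
       - cnj (x j) * x i * (of_bool (a = i) * of_bool (b = j))
       + cnj (x j) * x j * (of_bool (a = i) * of_bool (b = i)))"
      using ab True by (simp add: ent_simps ent_sum ent_outer scaleR_conv_of_real[where 'a=complex] algebra_simps)
    have norm: "complex_of_real ((vnorm d x)\<^sup>2) = (\<Sum>i<d. cnj (x i) * x i)"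
      unfolding vnorm_power2 of_real_sum
      by (intro sum.cong refl) (metis complex_norm_square mult.commute)
    \<comment> \<open>The four double sums of the expansion are evaluated one by one; the second and
      fourth are the first and third with the indices swapped.\<close>
    have "(\<Sum>i<d. \<Sum>j<d. cnj (x i) * x i * (of_bool (a = j) * of_bool (b = j))) =
        (\<Sum>i<d. \<Sum>j<d. if j = a then cnj (x i) * x i * of_bool (a = b) else 0)"
      by (intro sum.cong refl) auto
    also have "\<dots> = (\<Sum>i<d. cnj (x i) * x i) * of_bool (a = b)"
      using ab True by (simp add: sum_distrib_right)
    finally have 1: "(\<Sum>i<d. \<Sum>j<d. cnj (x i) * x i * (of_bool (a = j) * of_bool (b = j))) = \<dots>" .
    then have 2: "(\<Sum>i<d. \<Sum>j<d. cnj (x j) * x j * (of_bool (a = i) * of_bool (b = i))) =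
        (\<Sum>i<d. cnj (x i) * x i) * of_bool (a = b)"
      by (subst sum.swap)
    have "(\<Sum>i<d. \<Sum>j<d. cnj (x i) * x j * (of_bool (a = j) * of_bool (b = i))) =
        (\<Sum>i<d. \<Sum>j<d. if j = a then if i = b then cnj (x b) * x a else 0 else 0)"
      by (intro sum.cong refl) auto
    also have "\<dots> = x a * cnj (x b)"
      using ab True by simp
    finally have 3: "(\<Sum>i<d. \<Sum>j<d. cnj (x i) * x j * (of_bool (a = j) * of_bool (b = i))) = \<dots>" .
    then have 4: "(\<Sum>i<d. \<Sum>j<d. cnj (x j) * x i * (of_bool (a = i) * of_bool (b = j))) = x a * cnj (x b)"
      by (subst sum.swap)
    have "ent ?R d' a b = (\<Sum>i<d. cnj (x i) * x i) * of_bool (a = b) - x a * cnj (x b)"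
      unfolding eq sum.distrib sum_subtractf 1 2 3 4 by simp
    also have "\<dots> = ent ?L d' a b"
      using ab True unfolding norm[symmetric]
      by (simp add: ent_simps ent_outer unit_at.rep_eq scaleR_conv_of_real[where 'a=complex])
    finally show ?thesis by simp
  next
    case False
    then show ?thesis using ab by (simp add: ent_simps ent_sum ent_outer unit_at.rep_eq)
  qed
qed

text \<open>Lagrange's identity bounds each rank-one matrix by its squared norm times the identity
  of size \<open>d\<close>, and these bounds add up to \<open>unit_at d\<close>. The lemma serves
  both the normalised random matrices and the test states \<open>outer d x\<close>.\<close>

lemma effect_sum_outer:
  assumes "(\<Sum>k\<in>I. (vnorm d (v k))\<^sup>2) = 1"
  shows "effect (\<Sum>k\<in>I. outer d (v k))"
  unfolding effect_def
proof
  show "psd (\<Sum>k\<in>I. outer d (v k))" by (intro psd_sum psd_outer)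
  have "psd ((vnorm d x)\<^sup>2 *\<^sub>R unit_at d - outer d x)" for x
    unfolding lagrange_outer by (intro psd_scaleR psd_sum psd_outer) simp
  then have "psd (\<Sum>k\<in>I. (vnorm d (v k))\<^sup>2 *\<^sub>R unit_at d - outer d (v k))"
    by (intro psd_sum) auto
  also have "(\<Sum>k\<in>I. (vnorm d (v k))\<^sup>2 *\<^sub>R unit_at d - outer d (v k)) = unit_at d - (\<Sum>k\<in>I. outer d (v k))"
    using assms by (simp add: sum_subtractf flip: scaleR_left.sum)
  finally have 1: "psd (unit_at d - (\<Sum>k\<in>I. outer d (v k)))" .
  \<comment> \<open>The ring unit is the identity in every size; what remains beyond size
    \<open>d\<close> is a projection, hence a square.\<close>
  have "1 - unit_at d = (1 - unit_at d) * star (1 - unit_at d)"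
  proof -
    have "star (unit_at d) = unit_at d"
      by (rule matfam_eqI) (auto simp: star.rep_eq unit_at.rep_eq)
    moreover have "unit_at d * unit_at d = unit_at d"
    proof (rule matfam_eqI)
      fix d' i j :: nat assume "i < d'"
      then have "(\<Sum>l<d'. ent (unit_at d) d' i l * ent (unit_at d) d' l j) =
          (\<Sum>l<d'. if l = i then ent (unit_at d) d' i j else 0)"
        by (intro sum.cong refl) (auto simp: unit_at.rep_eq)
      with \<open>i < d'\<close> show "ent (unit_at d * unit_at d) d' i j = ent (unit_at d) d' i j"
        by (simp add: ent_simps)
    qed
    ultimately show ?thesis by (simp add: algebra_simps)
  qed
  then have "psd (1 - unit_at d)" using psd_square by metis
  from psd_add[OF this 1] show "psd (1 - (\<Sum>k\<in>I. outer d (v k)))" by simp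
qed

text \<open>Jensen's inequality for the state \<open>X\<close>, followed by \<open>X\<close> \<le>
  1. Consequently a single moment below \<open>a ^ p\<close> keeps every normalised quadratic form
  of \<open>H\<close> below \<open>a\<close>.\<close>

lemma tr_state_power_le:
  assumes X: "effect X" "tr d X = 1" and H: "psd H"
  shows "tr d (X * H) ^ p \<le> tr d (H ^ p)"
proof -
  define l where "l = tr d (X * H)"
  have psdX: "psd X" and psdX': "psd (1 - X)" using X by (auto simp: effect_def)
  have l: "0 \<le> l" using tr_psd_mult_nonneg[OF psdX H] by (simp add: l_def)
  let ?S = "H - l *\<^sub>R 1"
  have S: "star ?S = ?S" using psd_star[OF H] by simp
  \<comment> \<open>This is the matrix form of (h - l)(h^p - l^p) \<ge> 0 for h, l \<ge> 0, obtained
    by recursion on \<open>p\<close> instead of diagonalisation.\<close>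
  have psd: "psd (?S * (H ^ p - l ^ p *\<^sub>R 1))" for p
  proof (induction p)
    case (Suc p)
    have "?S * (H ^ Suc p - l ^ Suc p *\<^sub>R 1) = ?S * H ^ p * star ?S + l *\<^sub>R (?S * (H ^ p - l ^ p *\<^sub>R 1))"
      unfolding S by (simp add: algebra_simps power_commutes)
    then show ?case using Suc l by (auto intro!: psd_add psd_scaleR psd_conj psd_power H simp del: star_diff)
  qed (simp add: psd_0)
  have step: "l * tr d (X * H ^ p) \<le> tr d (X * H ^ Suc p)" for p
  proof -
    have "0 \<le> tr d (X * (?S * (H ^ p - l ^ p *\<^sub>R 1)))" by (intro tr_psd_mult_nonneg psdX psd)
    \<comment> \<open>Since \<open>X\<close> has trace 1 and \<open>l\<close> is the trace of
      \<open>X * H\<close>, the second and fourth terms cancel under the trace.\<close>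
    also have "X * (?S * (H ^ p - l ^ p *\<^sub>R 1)) = X * H ^ Suc p - l ^ p *\<^sub>R (X * H) - l *\<^sub>R (X * H ^ p) + l ^ Suc p *\<^sub>R X"
      by (simp add: algebra_simps)
    also have "tr d \<dots> = tr d (X * H ^ Suc p) - l * tr d (X * H ^ p)"
      by (simp add: tr_add tr_diff tr_scaleR X l_def)
    finally show ?thesis by simp
  qed
  have "l ^ p \<le> tr d (X * H ^ p)"
  proof (induction p)
    case (Suc p)
    then show ?case using step[of p] mult_left_mono[OF Suc l] by simp
  qed (simp add: X)
  also have "\<dots> \<le> tr d (H ^ p)"
    using tr_psd_mult_nonneg[OF psdX' psd_power[OF H], of d p] by (simp add: left_diff_distrib tr_diff)
  finally show ?thesis by (simp add: l_def)
qed

section \<open>From quadratic forms to vector norms\<close>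

lemma vnorm_eq_0_outer: "vnorm d x = 0 \<Longrightarrow> outer d x = 0"
  by (rule matfam_eqI) (auto simp: ent_outer ent_simps vnorm_def sum_nonneg_eq_0_iff)

text \<open>With \<open>P = \<delta> - M\<close> and \<open>N = \<delta> + M\<close>, the identity \<open>2 \<delta> (\<delta>\<^sup>2 - M\<^sup>2) = P N P + N P N\<close>
  turns two-sided bounds on the quadratic form of \<open>M\<close> into a norm bound.\<close>

lemma vnorm_le_of_quadratic_form:
  assumes M: "star M = M" and \<delta>: "0 < \<delta>"
    and bound: "\<And>x. vnorm d x = 1 \<Longrightarrow> \<bar>tr d (outer d x * M)\<bar> \<le> \<delta>"
  shows "vnorm d (\<lambda>i. \<Sum>l<d. ent M d i l * x l) \<le> \<delta> * vnorm d x"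
proof -
  have hom: "\<bar>tr d (outer d x * M)\<bar> \<le> \<delta> * (vnorm d x)\<^sup>2" for x
  proof (cases "vnorm d x = 0")
    case True
    then show ?thesis by (simp add: vnorm_eq_0_outer)
  next
    case False
    define c where "c = vnorm d x"
    have c: "c > 0" using False vnorm_nonneg[of d x] by (simp add: c_def)
    define y where "y i = complex_of_real (1 / c) * x i" for i
    have "outer d x = c\<^sup>2 *\<^sub>R outer d y"
      unfolding y_def[abs_def] outer_scaleR using c by (simp add: power_one_over)
    moreover have "vnorm d y = 1"
      unfolding y_def[abs_def] vnorm_scaleR using c by (simp flip: c_def)
    ultimately show ?thesis
      using bound[of y] c by (simp add: tr_scaleR abs_mult flip: c_def)
  qed
  let ?X = "outer d x"
  define P where "P = \<delta> *\<^sub>R 1 - M"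
  define N where "N = \<delta> *\<^sub>R 1 + M"
  have star: "star P = P" "star N = N" by (simp_all add: P_def N_def M)
  have "0 \<le> tr d (outer d y * P)" "0 \<le> tr d (outer d y * N)" for y
    using hom[of y] by (auto simp: P_def N_def right_diff_distrib distrib_left tr_add tr_diff tr_scaleR tr_outer)
  \<comment> \<open>By \<open>conj_outer\<close>, conjugating \<open>?X\<close> by \<open>P\<close>
    or \<open>N\<close> gives the rank-one matrix of an image vector, where the nonnegativity of the
    forms of \<open>N\<close> and \<open>P\<close> applies.\<close>
  then have "0 \<le> tr d (P * ?X * star P * N)" "0 \<le> tr d (N * ?X * star N * P)"
    unfolding conj_outer by auto
  then have "0 \<le> tr d (?X * (P * N * P)) + tr d (?X * (N * P * N))"
    unfolding star using tr_commute[of d P "?X * P * N"] tr_commute[of d N "?X * N * P"]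
    by (simp add: mult.assoc)
  also have "\<dots> = tr d (?X * (P * N * P + N * P * N))"
    by (simp add: distrib_left tr_add)
  also have "P * N * P + N * P * N = (2 * \<delta>) *\<^sub>R (\<delta>\<^sup>2 *\<^sub>R 1 - M * M)"
  proof -
    let ?W = "\<delta>\<^sup>2 *\<^sub>R 1 - M * M"
    have "P * N = ?W" "N * P = ?W"
      by (simp_all add: P_def N_def algebra_simps power2_eq_square)
    then have "P * N * P + N * P * N = ?W * (P + N)"
      by (simp only: distrib_left)
    also have "P + N = (2 * \<delta>) *\<^sub>R 1"
      by (simp add: P_def N_def flip: scaleR_left_distrib)
    finally show ?thesis by simp
  qed
  also have "tr d (?X * \<dots>) = 2 * \<delta> * (\<delta>\<^sup>2 * (vnorm d x)\<^sup>2 - tr d (?X * (M * M)))"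
    by (simp add: tr_scaleR right_diff_distrib tr_diff tr_outer)
  finally have "tr d (?X * (M * M)) \<le> \<delta>\<^sup>2 * (vnorm d x)\<^sup>2"
    using \<delta> by (simp add: zero_le_mult_iff)
  moreover have "tr d (?X * (M * M)) = tr d (M * ?X * star M)"
    using tr_commute[of d M "?X * M"] by (simp add: M mult.assoc)
  ultimately have "(vnorm d (\<lambda>i. \<Sum>l<d. ent M d i l * x l))\<^sup>2 \<le> (\<delta> * vnorm d x)\<^sup>2"
    unfolding conj_outer tr_outer by (simp add: power_mult_distrib)
  then show ?thesis by (rule power2_le_imp_le) (use \<delta> in \<open>simp add: vnorm_nonneg\<close>)
qed

section \<open>Spectral norm\<close>

lemma kvecs_scaleR:
  "K = \<real> \<or> K = UNIV \<Longrightarrow> x \<in> kvecs K d \<Longrightarrow> (\<lambda>i. complex_of_real c * x i) \<in> kvecs K d"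
  by (auto simp: kvecs_def)

lemma mat_mult_vec_scaleR:
  "mat_mult_vec d M (\<lambda>i. complex_of_real c * x i) = (\<lambda>i. complex_of_real c * mat_mult_vec d M x i)"
  by (simp add: mat_mult_vec_def sum_distrib_left mult_ac)

lemma cmod_le_vnorm: "i < d \<Longrightarrow> cmod (x i) \<le> vnorm d x"
  unfolding vnorm_def by (intro real_le_rsqrt member_le_sum) auto

text \<open>Boundedness is what makes the supremum in \<open>spec_norm\<close> an actual upper
  bound; a crude entrywise estimate suffices.\<close>

lemma bdd_above_spec_norm:
  "bdd_above {vnorm d (mat_mult_vec d M x) | x. x \<in> kvecs K d \<and> vnorm d x = 1}"
proof (intro bdd_aboveI)
  fix y assume "y \<in> {vnorm d (mat_mult_vec d M x) | x. x \<in> kvecs K d \<and> vnorm d x = 1}"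
  then obtain x where y: "y = vnorm d (mat_mult_vec d M x)" and x: "vnorm d x = 1" by auto
  have "cmod (mat_mult_vec d M x i) \<le> (\<Sum>l<d. cmod (M (i, l)))" for i
  proof -
    have "cmod (mat_mult_vec d M x i) \<le> (\<Sum>l<d. cmod (M (i, l) * x l))"
      unfolding mat_mult_vec_def by (rule norm_sum)
    also have "\<dots> \<le> (\<Sum>l<d. cmod (M (i, l)))"
      using cmod_le_vnorm[of _ d x] x by (intro sum_mono) (simp add: norm_mult mult_left_le)
    finally show ?thesis .
  qed
  then show "y \<le> sqrt (\<Sum>i<d. (\<Sum>l<d. cmod (M (i, l)))\<^sup>2)"
    unfolding y vnorm_def by (intro real_sqrt_le_mono sum_mono power_mono) auto
qed

lemma spec_norm_le:
  assumes "K = \<real> \<or> K = UNIV" "1 \<le> d"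
    and "\<And>x. x \<in> kvecs K d \<Longrightarrow> vnorm d (mat_mult_vec d M x) \<le> c * vnorm d x"
  shows "spec_norm K d M \<le> c"
  unfolding spec_norm_def
proof (rule cSup_least)
  \<comment> \<open>The first basis vector lies in K^d for either field and shows that the supremum
    ranges over a nonempty set.\<close>
  let ?e = "\<lambda>i::nat. of_bool (i = 0) :: complex"
  have "vnorm d ?e = sqrt (\<Sum>i<d. if i = 0 then 1 else 0)"
    unfolding vnorm_def by (intro arg_cong[of _ _ sqrt] sum.cong) auto
  also have "\<dots> = 1" using assms(2) by simp
  finally have "vnorm d ?e = 1" .
  moreover have "?e \<in> kvecs K d" using assms(1) by (auto simp: kvecs_def)
  ultimately show "{vnorm d (mat_mult_vec d M x) | x. x \<in> kvecs K d \<and> vnorm d x = 1} \<noteq> {}"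
    by blast
qed (use assms(3) in fastforce)

lemma vnorm_mat_mult_vec_le:
  assumes "K = \<real> \<or> K = UNIV" "x \<in> kvecs K d"
  shows "vnorm d (mat_mult_vec d M x) \<le> spec_norm K d M * vnorm d x"
proof (cases "vnorm d x = 0")
  case True
  then have "x i = 0" if "i < d" for i
    using cmod_le_vnorm[OF that, of x] by simp
  then have "vnorm d (mat_mult_vec d M x) = 0"
    by (simp add: vnorm_def mat_mult_vec_def)
  then show ?thesis using True by simp
next
  case False
  define c where "c = vnorm d x"
  have c: "c > 0" using False vnorm_nonneg[of d x] by (simp add: c_def)
  define y where "y i = complex_of_real (1 / c) * x i" for i
  have "y \<in> kvecs K d" unfolding y_def[abs_def] using assms by (rule kvecs_scaleR)
  moreover have "vnorm d y = 1"
    unfolding y_def[abs_def] vnorm_scaleR using c by (simp flip: c_def)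
  ultimately have "vnorm d (mat_mult_vec d M y) \<le> spec_norm K d M"
    unfolding spec_norm_def by (intro cSup_upper bdd_above_spec_norm) auto
  moreover have "vnorm d (mat_mult_vec d M y) = vnorm d (mat_mult_vec d M x) / c"
    unfolding y_def[abs_def] mat_mult_vec_scaleR vnorm_scaleR using c by simp
  ultimately show ?thesis using c by (simp add: field_simps flip: c_def)
qed

text \<open>The supremum over uncountably many vectors is reduced to countably many by density and
  continuity.\<close>

lemma sets_spec_norm_less:
  assumes K: "K = \<real> \<or> K = UNIV" and "1 \<le> d"
    and M: "\<And>i l. i < d \<Longrightarrow> l < d \<Longrightarrow> (\<lambda>\<omega>. M \<omega> (i, l)) \<in> borel_measurable P"
  shows "{\<omega> \<in> space P. spec_norm K d (M \<omega>) < \<epsilon>} \<in> sets P"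
proof -
  obtain C where C: "countable C" "C \<subseteq> K" "K \<subseteq> closure C"
    by (rule separable)
  \<comment> \<open>These vectors are not normalised; the homogeneous inequality with
    \<open>c * vnorm d y\<close> avoids a dense subset of the unit sphere.\<close>
  let ?Q = "PiE {..<d} (\<lambda>_. C)"
  \<comment> \<open>The margins express the strict inequality as a countable union of non-strict
    ones.\<close>
  let ?c = "\<lambda>m. \<epsilon> - 1 / real (Suc m)"
  have Q: "?Q \<subseteq> kvecs K d" using C by (auto simp: kvecs_def)
  have dense: "vnorm d (mat_mult_vec d A x) \<le> c * vnorm d x"
    if le: "\<forall>y\<in>?Q. vnorm d (mat_mult_vec d A y) \<le> c * vnorm d y" and x: "x \<in> kvecs K d" for A c x
  proof -
    have "\<exists>s. \<forall>m. s m \<in> C \<and> s \<longlonglongrightarrow> x i" if "i < d" for i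
      using that x C closure_sequential[of "x i" C] by (auto simp: kvecs_def)
    then obtain s where s: "\<And>i m. i < d \<Longrightarrow> s i m \<in> C" "\<And>i. i < d \<Longrightarrow> s i \<longlonglongrightarrow> x i"
      by metis
    define y where "y m = restrict (\<lambda>i. s i m) {..<d}" for m
    have y: "(\<lambda>m. y m i) \<longlonglongrightarrow> x i" if "i < d" for i
      using s(2)[OF that] that by (simp add: y_def)
    have "(\<lambda>m. vnorm d (mat_mult_vec d A (y m))) \<longlonglongrightarrow> vnorm d (mat_mult_vec d A x)"
      unfolding vnorm_def mat_mult_vec_def by (intro tendsto_intros y) auto
    moreover have "(\<lambda>m. c * vnorm d (y m)) \<longlonglongrightarrow> c * vnorm d x"
      unfolding vnorm_def by (intro tendsto_intros y) auto
    moreover have "y m \<in> ?Q" for m using s(1) by (auto simp: y_def)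
    then have "\<exists>N. \<forall>m\<ge>N. vnorm d (mat_mult_vec d A (y m)) \<le> c * vnorm d (y m)" using le by blast
    ultimately show ?thesis by (rule LIMSEQ_le)
  qed
  have iff: "spec_norm K d A < \<epsilon> \<longleftrightarrow>
      (\<exists>m. \<forall>y\<in>?Q. vnorm d (mat_mult_vec d A y) \<le> ?c m * vnorm d y)" for A
  proof
    assume "spec_norm K d A < \<epsilon>"
    then obtain m where m: "inverse (real (Suc m)) < \<epsilon> - spec_norm K d A"
      using reals_Archimedean[of "\<epsilon> - spec_norm K d A"] by auto
    have "vnorm d (mat_mult_vec d A y) \<le> ?c m * vnorm d y" if "y \<in> ?Q" for y
    proof -
      have "vnorm d (mat_mult_vec d A y) \<le> spec_norm K d A * vnorm d y"
        using Q that by (intro vnorm_mat_mult_vec_le K) auto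
      also have "\<dots> \<le> ?c m * vnorm d y"
        using m by (intro mult_right_mono vnorm_nonneg) (simp add: inverse_eq_divide)
      finally show ?thesis .
    qed
    then show "\<exists>m. \<forall>y\<in>?Q. vnorm d (mat_mult_vec d A y) \<le> ?c m * vnorm d y" by blast
  next
    assume "\<exists>m. \<forall>y\<in>?Q. vnorm d (mat_mult_vec d A y) \<le> ?c m * vnorm d y"
    then obtain m where "\<forall>y\<in>?Q. vnorm d (mat_mult_vec d A y) \<le> ?c m * vnorm d y" ..
    then have "spec_norm K d A \<le> ?c m"
      by (intro spec_norm_le K assms(2) dense)
    also have "\<dots> < \<epsilon>" by simp
    finally show "spec_norm K d A < \<epsilon>" .
  qed
  have "countable ?Q" using C by (intro countable_PiE) auto
  moreover have "(\<lambda>\<omega>. vnorm d (mat_mult_vec d (M \<omega>) y)) \<in> borel_measurable P" for y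
    unfolding vnorm_def mat_mult_vec_def
    by (intro borel_measurable_sqrt[THEN measurable_compose[rotated]] borel_measurable_sum
        borel_measurable_power borel_measurable_norm[THEN measurable_compose[rotated]]
        borel_measurable_times M) auto
  then have "{\<omega> \<in> space P. vnorm d (mat_mult_vec d (M \<omega>) y) \<le> ?c m * vnorm d y} \<in> sets P" for y m
    by measurable
  ultimately show ?thesis unfolding iff
    by (intro sets.sets_Collect_countable_Ex sets.sets_Collect_countable_All')
qed

text \<open>This is \<open>T\<close> times its adjoint, divided by \<open>R\<close>. The value 0 off
  the event of correct Hilbert-Schmidt norm makes it an effect for every \<open>T\<close>, not only
  almost surely.\<close>

definition frame_effect :: "nat \<Rightarrow> nat \<Rightarrow> real \<Rightarrow> (nat \<times> nat \<Rightarrow> complex) \<Rightarrow> matfam" where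
  "frame_effect d r R T =
     (if hs_norm_sq d r T = R then (1 / R) *\<^sub>R (\<Sum>k<r. outer d (\<lambda>i. T (i, k))) else 0)"

lemma hs_norm_sq_columns: "hs_norm_sq d r T = (\<Sum>k<r. (vnorm d (\<lambda>i. T (i, k)))\<^sup>2)"
  unfolding hs_norm_sq_def vnorm_power2 by (rule sum.swap)

text \<open>The columns of \<open>T\<close> divided by \<open>sqrt R\<close> have squared norms with
  sum 1.\<close>

lemma effect_frame_effect:
  assumes "R > 0"
  shows "effect (frame_effect d r R T)"
proof (cases "hs_norm_sq d r T = R")
  case True
  let ?v = "\<lambda>k i. complex_of_real (1 / sqrt R) * T (i, k)"
  have "(\<Sum>k<r. (vnorm d (?v k))\<^sup>2) = 1"
    using assms True unfolding vnorm_scaleR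
    by (simp add: power_mult_distrib power_divide hs_norm_sq_columns flip: sum_divide_distrib)
  then have "effect (\<Sum>k<r. outer d (?v k))" by (rule effect_sum_outer)
  also have "(\<Sum>k<r. outer d (?v k)) = frame_effect d r R T"
    using assms True unfolding outer_scaleR
    by (simp add: frame_effect_def power_divide flip: scaleR_sum_right)
  finally show ?thesis .
next
  case False
  then show ?thesis by (simp add: frame_effect_def effect_def psd_0 psd_1)
qed

lemma effect_compl: "effect Y \<Longrightarrow> effect (1 - Y)"
  by (simp add: effect_def)

lemma ent_frame_effect:
  assumes "hs_norm_sq d r T = R" "i < d" "l < d"
  shows "ent (frame_effect d r R T) d i l = of_real (1 / R) * (\<Sum>k<r. T (i, k) * cnj (T (l, k)))"
  using assms by (simp add: frame_effect_def ent_simps ent_sum ent_outer scaleR_conv_of_real[where 'a=complex])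

text \<open>A crude bound, used only for integrability: every entry of \<open>T\<close> has modulus
  at most \<open>sqrt R\<close>.\<close>

lemma cmod_ent_frame_effect_le:
  assumes "R > 0"
  shows "cmod (ent (frame_effect d r R T) d i l) \<le> real r"
proof (cases "hs_norm_sq d r T = R \<and> i < d \<and> l < d")
  case True
  have le: "cmod (T (m, k)) \<le> sqrt R" if "m < d" "k < r" for m k
  proof -
    have "(cmod (T (m, k)))\<^sup>2 \<le> (vnorm d (\<lambda>i. T (i, k)))\<^sup>2"
      using cmod_le_vnorm[OF that(1), of "\<lambda>i. T (i, k)"] by (simp add: power_mono)
    also have "\<dots> \<le> R"
      using that(2) True unfolding hs_norm_sq_columns by (auto intro!: member_le_sum)
    finally show ?thesis by (rule real_le_rsqrt)
  qed
  have "cmod (\<Sum>k<r. T (i, k) * cnj (T (l, k))) \<le> (\<Sum>k<r. R)"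
  proof (rule sum_norm_le)
    fix k assume "k \<in> {..<r}"
    then have "cmod (T (i, k)) * cmod (T (l, k)) \<le> sqrt R * sqrt R"
      using le True assms by (intro mult_mono) auto
    then show "cmod (T (i, k) * cnj (T (l, k))) \<le> R"
      using assms by (simp add: norm_mult)
  qed
  then show ?thesis
    using True assms by (simp add: ent_frame_effect norm_mult norm_divide field_simps)
next
  case False
  then show ?thesis by (auto simp: ent_outside) (simp add: frame_effect_def ent_simps)
qed

section \<open>The mean of a tight g-frame\<close>

lemma quadratic_form_two_entries:
  fixes m :: "nat \<Rightarrow> nat \<Rightarrow> complex" and c :: complex
  assumes "i < d" "l < d"
  defines "x \<equiv> \<lambda>a. of_bool (a = i) + c * of_bool (a = l)"
  shows "(\<Sum>a<d. \<Sum>b<d. x a * cnj (x b) * m b a) = m i i + cnj c * m l i + c * m i l + c * cnj c * m l l"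
proof -
  have lin: "(\<Sum>a<d. (of_bool (a = i) + e * of_bool (a = l)) * f a) = f i + e * f l" for e and f :: "nat \<Rightarrow> complex"
  proof -
    have "(\<Sum>a<d. (of_bool (a = i) + e * of_bool (a = l)) * f a) =
        (\<Sum>a<d. (if a = i then f i else 0) + (if a = l then e * f l else 0))"
      by (intro sum.cong) (auto simp: distrib_right)
    then show ?thesis using assms(1,2) by (simp add: sum.distrib)
  qed
  have "cnj (x b) = of_bool (b = i) + cnj c * of_bool (b = l)" for b
    by (simp add: x_def of_bool_def)
  then have "(\<Sum>a<d. \<Sum>b<d. x a * cnj (x b) * m b a) = (\<Sum>a<d. x a * (m i a + cnj c * m l a))"
    by (simp add: mult.assoc lin flip: sum_distrib_left)
  also have "\<dots> = m i i + cnj c * m l i + c * (m i l + cnj c * m l l)"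
    unfolding x_def by (rule lin)
  finally show ?thesis by (simp add: algebra_simps)
qed

text \<open>Polarisation with the vectors e_i + c e_l: \<open>c = 0\<close> handles the diagonal,
  \<open>c = 1\<close> the real parts. The choice \<open>c = \<i>\<close> gives the imaginary parts
  but is available only over the complex field; over the reals these vanish by assumption.\<close>

lemma hermitian_form_zero:
  fixes m :: "nat \<Rightarrow> nat \<Rightarrow> complex"
  assumes K: "K = UNIV \<or> K = \<real> \<and> (\<forall>i<d. \<forall>l<d. m i l \<in> \<real>)"
    and herm: "\<And>i l. i < d \<Longrightarrow> l < d \<Longrightarrow> m l i = cnj (m i l)"
    and zero: "\<And>x. x \<in> kvecs K d \<Longrightarrow> Re (\<Sum>a<d. \<Sum>b<d. x a * cnj (x b) * m b a) = 0"
    and "i < d" "l < d"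
  shows "m i l = 0"
proof -
  have eq: "Re (m i i + cnj c * m l i + c * m i l + c * cnj c * m l l) = 0"
    if "c \<in> K" "i < d" "l < d" for i l c
  proof -
    have "(\<lambda>a. of_bool (a = i) + c * of_bool (a = l)) \<in> kvecs K d"
      using K that by (auto simp: kvecs_def)
    from zero[OF this] show ?thesis unfolding quadratic_form_two_entries[OF that(2,3)] .
  qed
  have diag: "Re (m i i) = 0" if "i < d" for i
    using eq[of 0 i i] K that by auto
  have Re: "Re (m i l) = 0"
    using eq[of 1 i l] K diag assms(4,5) herm[of i l] by auto
  have "Im (m i l) = 0"
  proof (cases "K = UNIV")
    case True
    then show ?thesis using eq[of \<i> i l] diag assms(4,5) herm[of i l] by auto
  next
    case False
    then show ?thesis using K assms(4,5) by (simp add: complex_is_Real_iff)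
  qed
  with Re show ?thesis by (simp add: complex_eq_iff)
qed

lemma cmod_adj_mult_sum:
  "complex_of_real ((vnorm r (adj_mult d T x))\<^sup>2) =
     (\<Sum>a<d. \<Sum>b<d. x a * cnj (x b) * (\<Sum>k<r. T (b, k) * cnj (T (a, k))))"
proof -
  have "complex_of_real ((vnorm r (adj_mult d T x))\<^sup>2) =
      (\<Sum>k<r. (\<Sum>a<d. cnj (T (a, k)) * x a) * cnj (\<Sum>b<d. cnj (T (b, k)) * x b))"
    unfolding vnorm_power2 adj_mult_def of_real_sum by (simp only: complex_norm_square)
  also have "\<dots> = (\<Sum>k<r. \<Sum>a<d. \<Sum>b<d. x a * cnj (x b) * (T (b, k) * cnj (T (a, k))))"
    by (simp add: sum_product mult_ac)
  also have "\<dots> = (\<Sum>a<d. \<Sum>k<r. \<Sum>b<d. x a * cnj (x b) * (T (b, k) * cnj (T (a, k))))"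
    by (rule sum.swap)
  also have "\<dots> = (\<Sum>a<d. \<Sum>b<d. \<Sum>k<r. x a * cnj (x b) * (T (b, k) * cnj (T (a, k))))"
    by (intro sum.cong refl sum.swap)
  finally show ?thesis by (simp add: sum_distrib_left)
qed

lemma measurable_matspace_entry:
  assumes "sets D = sets (matspace d r)" "i < d" "k < r"
  shows "(\<lambda>T. T (i, k)) \<in> borel_measurable D"
  unfolding measurable_cong_sets[OF assms(1) refl] matspace_def
  using assms by (intro measurable_component_singleton) auto

lemma borel_measurable_frame_effect:
  assumes D: "sets D = sets (matspace d r)"
  shows "(\<lambda>T. ent (frame_effect d r R T) d i l) \<in> borel_measurable D"
proof (cases "i < d \<and> l < d")
  case True
  have entry [measurable]: "(\<lambda>T. T (i, k)) \<in> borel_measurable D" if "i < d" "k < r" for i k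
    using measurable_matspace_entry[OF D that] .
  have "(\<lambda>T. hs_norm_sq d r T) \<in> borel_measurable D"
    unfolding hs_norm_sq_def
    by (intro borel_measurable_sum borel_measurable_power measurable_compose[OF _ borel_measurable_norm] entry) auto
  then have "{T \<in> space D. hs_norm_sq d r T = R} \<in> sets D"
    by measurable
  then have "(\<lambda>T. if hs_norm_sq d r T = R then of_real (1 / R) * (\<Sum>k<r. T (i, k) * cnj (T (l, k))) else 0)
      \<in> borel_measurable D"
    using True
    by (intro measurable_If borel_measurable_times borel_measurable_sum borel_measurable_const
        measurable_compose[OF _ borel_measurable_continuous_onI[OF continuous_on_cnj[OF continuous_on_id]]] entry) auto
  also have "(\<lambda>T. if hs_norm_sq d r T = R then of_real (1 / R) * (\<Sum>k<r. T (i, k) * cnj (T (l, k))) else 0) =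
      (\<lambda>T. ent (frame_effect d r R T) d i l)"
    using True by (auto simp: ent_frame_effect fun_eq_iff) (simp add: frame_effect_def ent_simps)
  finally show ?thesis .
next
  case False
  then show ?thesis by (simp add: ent_outside)
qed

lemma integrable_frame_effect:
  assumes "prob_space D" "sets D = sets (matspace d r)" "R > 0"
  shows "integrable D (\<lambda>T. ent (frame_effect d r R T) d i l)"
proof -
  interpret prob_space D by fact
  show ?thesis
    by (intro integrable_const_bound[of _ "real r"] borel_measurable_frame_effect assms)
       (simp add: cmod_ent_frame_effect_le assms)
qed

text \<open>Tightness makes the form of the mean equal to \<open>A / R\<close> times the squared
  norm, so by polarisation the mean is a multiple of the identity. Its trace is 1, which fixes the
  multiple as \<open>1 / d\<close>.\<close>

lemma mean_frame_effect:
  assumes K: "K = \<real> \<or> K = UNIV" and R: "R > 0"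
    and D: "prob_space D" "sets D = sets (matspace d r)"
    and AE_K: "AE T in D. T \<in> kmats K d r" and tight: "tight_rgframe K d r D 1"
    and AE_R: "AE T in D. hs_norm_sq d r T = R"
    and il: "i < d" "l < d"
  shows "(\<integral>T. ent (frame_effect d r R T) d i l \<partial>D) = (if i = l then of_real (1 / d) else 0)"
proof -
  interpret prob_space D by fact
  let ?Y = "frame_effect d r R"
  note int = integrable_frame_effect[OF D R]
  obtain A where A: "\<And>x. x \<in> kvecs K d \<Longrightarrow>
      (\<integral>T. (vnorm r (adj_mult d T x))\<^sup>2 \<partial>D) = A * (vnorm d x)\<^sup>2"
    using tight unfolding tight_rgframe_def rgframe_bounds_def by fastforce
  define m where "m i l = (\<integral>T. ent (?Y T) d i l \<partial>D)" for i l
  have quad: "R * Re (\<Sum>a<d. \<Sum>b<d. x a * cnj (x b) * m b a) = A * (vnorm d x)\<^sup>2" if x: "x \<in> kvecs K d" for x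
  proof -
    let ?q = "\<lambda>T. \<Sum>a<d. \<Sum>b<d. x a * cnj (x b) * ent (?Y T) d b a"
    have intq: "integrable D ?q"
      by (intro Bochner_Integration.integrable_sum integrable_mult_right int)
    have "(\<integral>T. ?q T \<partial>D) = (\<Sum>a<d. \<Sum>b<d. x a * cnj (x b) * m b a)"
      by (simp add: m_def Bochner_Integration.integral_sum int)
    then have "R * Re (\<Sum>a<d. \<Sum>b<d. x a * cnj (x b) * m b a) = (\<integral>T. R * Re (?q T) \<partial>D)"
      by (simp only: integral_mult_right_zero integral_Re[OF intq])
    also have "\<dots> = (\<integral>T. (vnorm r (adj_mult d T x))\<^sup>2 \<partial>D)"
    proof (rule integral_cong_AE)
      show "(\<lambda>T. R * Re (?q T)) \<in> borel_measurable D"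
        by (intro borel_measurable_times borel_measurable_const
            measurable_compose[OF borel_measurable_integrable[OF intq] borel_measurable_Re])
      show "(\<lambda>T. (vnorm r (adj_mult d T x))\<^sup>2) \<in> borel_measurable D"
        unfolding vnorm_power2 adj_mult_def
        by (intro borel_measurable_sum borel_measurable_power measurable_compose[OF _ borel_measurable_norm]
            borel_measurable_times borel_measurable_const measurable_matspace_entry[OF D(2)]
            measurable_compose[OF _ borel_measurable_continuous_onI[OF continuous_on_cnj[OF continuous_on_id]]]) auto
      show "AE T in D. R * Re (?q T) = (vnorm r (adj_mult d T x))\<^sup>2"
        using AE_R
      proof eventually_elim
        case (elim T)
        have "complex_of_real R * ?q T = complex_of_real ((vnorm r (adj_mult d T x))\<^sup>2)"
          unfolding cmod_adj_mult_sum sum_distrib_left[of "complex_of_real R"]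
          using R elim by (intro sum.cong refl) (simp add: ent_frame_effect)
        then have "Re (complex_of_real R * ?q T) = (vnorm r (adj_mult d T x))\<^sup>2"
          by (simp only: Re_complex_of_real)
        then show ?case by simp
      qed
    qed
    finally show ?thesis using A[OF x] by simp
  qed
  \<comment> \<open>The deviation of the mean from the expected multiple of the identity; it is
    shown to have vanishing form.\<close>
  define m' where "m' i l = m i l - of_real (A / R) * of_bool (i = l)" for i l
  have herm: "m l i = cnj (m i l)" for i l
  proof -
    have "ent (?Y T) d l i = cnj (ent (?Y T) d i l)" for T
      using psd_star[of "?Y T"] effect_frame_effect[OF R, of d r T]
      by (metis effect_def star.rep_eq)
    then show ?thesis by (simp add: m_def integral_cnj)
  qed
  have m'0: "m' i l = 0" if "i < d" "l < d" for i l
  proof (rule hermitian_form_zero[OF _ _ _ that])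
    show "K = UNIV \<or> K = \<real> \<and> (\<forall>i<d. \<forall>l<d. m' i l \<in> \<real>)"
    proof (cases "K = UNIV")
      case False
      then have KR: "K = \<real>" using K by simp
      have "m i l \<in> \<real>" if "i < d" "l < d" for i l
      proof -
        have "Im (m i l) = (\<integral>T. Im (ent (?Y T) d i l) \<partial>D)"
          unfolding m_def by (simp add: int)
        also have "\<dots> = (\<integral>T. 0 \<partial>D)"
        proof (rule integral_cong_AE)
          show "(\<lambda>T. Im (ent (?Y T) d i l)) \<in> borel_measurable D"
            using borel_measurable_integrable[OF int] by simp
          show "AE T in D. Im (ent (?Y T) d i l) = 0"
            using AE_K AE_R
          proof eventually_elim
            case (elim T)
            have "cnj z \<in> \<real>" if "z \<in> \<real>" for z
              using that by (simp add: complex_is_Real_iff)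
            then have "ent (?Y T) d i l \<in> \<real>"
              using elim that KR
              by (auto simp: ent_frame_effect kmats_def intro!: Reals_mult sum_in_Reals Reals_of_real simp del: of_real_divide)
            then show ?case by (simp add: complex_is_Real_iff)
          qed
        qed simp
        finally show ?thesis by (simp add: complex_is_Real_iff)
      qed
      then show ?thesis using KR by (auto simp: m'_def intro!: Reals_diff Reals_mult Reals_of_real simp del: of_real_divide)
    qed simp
    show "m' l i = cnj (m' i l)" for i l
      using herm[of l i] by (simp add: m'_def of_bool_def)
    show "Re (\<Sum>a<d. \<Sum>b<d. x a * cnj (x b) * m' b a) = 0" if x: "x \<in> kvecs K d" for x
    proof -
      have "(\<Sum>a<d. \<Sum>b<d. x a * cnj (x b) * of_bool (b = a)) = (\<Sum>a<d. complex_of_real ((cmod (x a))\<^sup>2))"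
      proof (intro sum.cong refl)
        fix a assume "a \<in> {..<d}"
        moreover have "(\<Sum>b<d. x a * cnj (x b) * of_bool (b = a)) = (\<Sum>b<d. if b = a then x a * cnj (x a) else 0)"
          by (intro sum.cong) auto
        ultimately show "(\<Sum>b<d. x a * cnj (x b) * of_bool (b = a)) = complex_of_real ((cmod (x a))\<^sup>2)"
          by (simp only: complex_norm_square) simp
      qed
      then have 1: "(\<Sum>a<d. \<Sum>b<d. x a * cnj (x b) * of_bool (b = a)) = complex_of_real ((vnorm d x)\<^sup>2)"
        by (simp add: vnorm_power2)
      have "(\<Sum>a<d. \<Sum>b<d. x a * cnj (x b) * m' b a) =
          (\<Sum>a<d. \<Sum>b<d. x a * cnj (x b) * m b a) - of_real (A / R) * (\<Sum>a<d. \<Sum>b<d. x a * cnj (x b) * of_bool (b = a))"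
        by (simp add: m'_def right_diff_distrib sum_subtractf sum_distrib_left mult_ac)
      then have "Re (\<Sum>a<d. \<Sum>b<d. x a * cnj (x b) * m' b a) =
          Re (\<Sum>a<d. \<Sum>b<d. x a * cnj (x b) * m b a) - A / R * (vnorm d x)\<^sup>2"
        unfolding 1 by (simp flip: of_real_mult of_real_divide)
      then show ?thesis using quad[OF x] R by (simp add: field_simps)
    qed
  qed
  \<comment> \<open>Almost surely the trace of the frame effect is the squared Hilbert-Schmidt norm
    divided by \<open>R\<close>.\<close>
  have "1 = (\<integral>T. (\<Sum>a<d. ent (?Y T) d a a) \<partial>D)"
  proof -
    have "(\<integral>T. (\<Sum>a<d. ent (?Y T) d a a) \<partial>D) = (\<integral>T. 1 \<partial>D)"
    proof (rule integral_cong_AE)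
      show "(\<lambda>T. \<Sum>a<d. ent (?Y T) d a a) \<in> borel_measurable D"
        by (intro borel_measurable_sum borel_measurable_frame_effect D)
      show "AE T in D. (\<Sum>a<d. ent (?Y T) d a a) = 1"
        using AE_R
      proof eventually_elim
        case (elim T)
        have "(\<Sum>a<d. ent (?Y T) d a a) = (\<Sum>a<d. of_real (1 / R) * complex_of_real (\<Sum>k<r. (cmod (T (a, k)))\<^sup>2))"
          unfolding of_real_sum complex_norm_square using elim by (intro sum.cong refl) (simp add: ent_frame_effect)
        also have "\<dots> = of_real (1 / R * hs_norm_sq d r T)"
          unfolding hs_norm_sq_def by (simp flip: sum_divide_distrib)
        finally show ?case using elim R by simp
      qed
    qed simp
    then show ?thesis by (simp add: prob_space)
  qed
  also have "\<dots> = (\<Sum>a<d. m a a)"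
    by (simp add: m_def Bochner_Integration.integral_sum int)
  also have "\<dots> = (\<Sum>a<d. of_real (A / R))"
    using m'0 by (intro sum.cong refl) (force simp: m'_def)
  finally have "of_real (A / R) = (of_real (1 / d) :: complex)"
    using il by (simp add: field_simps)
  then show ?thesis using m'0[OF il] by (simp add: m_def m'_def of_bool_def split: if_splits)
qed

section \<open>Concentration\<close>

text \<open>The Poisson large deviation rate: for \<open>y > 0\<close>, the maximum over
  \<open>\<theta>\<close> of \<open>\<theta> * y - (exp \<theta> - 1)\<close>, attained at
  \<open>\<theta> = ln y\<close>.\<close>

definition chernoff_rate :: "real \<Rightarrow> real" where
  "chernoff_rate y = y * ln y - y + 1"

text \<open>The strict inequality ln u < u - 1 at u = 1 / y, multiplied by \<open>y\<close>.\<close>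

lemma chernoff_rate_pos:
  assumes "0 < y" "y \<noteq> 1"
  shows "0 < chernoff_rate y"
proof -
  have "ln (1 / y) < 1 / y - 1"
    using ln_le_minus_one[of "1 / y"] ln_eq_minus_one[of "1 / y"] assms
    by (fastforce simp: less_le)
  then show ?thesis using assms by (simp add: chernoff_rate_def ln_div field_simps)
qed

lemma one_plus_power_le_exp: "-1 \<le> x \<Longrightarrow> (1 + x) ^ n \<le> exp (real n * (x::real))"
  using power_mono[OF exp_ge_add_one_self[of x], of n] by (simp add: exp_of_nat_mult)

lemma sets_frame_event:
  fixes n :: nat
  assumes K: "K = \<real> \<or> K = UNIV" and d: "1 \<le> d" and D: "sets D = sets (matspace d r)"
  defines "P \<equiv> PiM {..<n} (\<lambda>_. D)"
  shows "{Ts \<in> space P. spec_norm K d (id_minus d (frame_op d r R n Ts)) < \<epsilon>} \<in> sets P"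
  using K d
proof (rule sets_spec_norm_less)
  have entry: "(\<lambda>Ts. Ts j (i, k)) \<in> borel_measurable P" if "i < d" "k < r" "j < n" for i k j
  proof -
    have "(\<lambda>Ts. Ts j) \<in> measurable P D"
      unfolding P_def using that by (intro measurable_component_singleton) auto
    from measurable_compose[OF this measurable_matspace_entry[OF D that(1,2)]] show ?thesis .
  qed
  fix i l assume "i < d" "l < d"
  then show "(\<lambda>Ts. id_minus d (frame_op d r R n Ts) (i, l)) \<in> borel_measurable P"
    unfolding id_minus_def frame_op_def split
    by (intro borel_measurable_diff borel_measurable_const borel_measurable_sum borel_measurable_times
        measurable_compose[OF _ borel_measurable_continuous_onI[OF continuous_on_cnj[OF continuous_on_id]]] entry) auto
qed

text \<open>The upper tail uses the effects \<open>Y\<close>, the lower tail their complements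
  \<open>1 - Y\<close>. Off both tail events all quadratic forms of the deviation lie within
  \<open>\<delta>\<close>, which bounds its norm.\<close>

lemma frame_concentration:
  fixes n :: nat
  assumes K: "K = \<real> \<or> K = UNIV" and d: "1 \<le> d" and n: "1 \<le> n" and R: "R > 0"
    and D: "prob_space D" "sets D = sets (matspace d r)"
    and AE_K: "AE T in D. T \<in> kmats K d r" and tight: "tight_rgframe K d r D 1"
    and AE_R: "AE T in D. hs_norm_sq d r T = R"
    and \<delta>: "0 < \<delta>" "\<delta> < 1" "\<delta> < \<epsilon>"
    and \<kappa>: "\<kappa> \<le> chernoff_rate (1 + \<delta>)" "\<kappa> \<le> chernoff_rate (1 - \<delta>)"
  defines "P \<equiv> PiM {..<n} (\<lambda>_. D)"
  shows "1 - 2 * real d * exp (- \<kappa> * real n / real d)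
    \<le> measure P {Ts \<in> space P. spec_norm K d (id_minus d (frame_op d r R n Ts)) < \<epsilon>}"
    (is "_ \<le> measure P ?S")
proof -
  interpret P: prob_space P unfolding P_def by (intro prob_space_PiM D)
  let ?Y = "frame_effect d r R"
  define H where "H Ts = (\<Sum>j<n. ?Y (Ts j))" for Ts
  define H' where "H' Ts = (\<Sum>j<n. 1 - ?Y (Ts j))" for Ts
  \<comment> \<open>The sums \<open>H\<close> and \<open>H'\<close> add up to \<open>n\<close> times
    the identity, so a form of \<open>H'\<close> below \<open>a'\<close> means a form of
    \<open>H\<close> above \<open>(1 - \<delta>) * n / d\<close>.\<close>
  define a where "a = (1 + \<delta>) * n / d"
  define a' where "a' = n - (1 - \<delta>) * n / d"
  have a: "0 \<le> a" using \<delta> by (simp add: a_def)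
  have a': "0 \<le> a'"
  proof -
    have "(1 - \<delta>) * n \<le> 1 * real n" using \<delta> by (intro mult_right_mono) auto
    also have "\<dots> \<le> real d * n" using d by (intro mult_right_mono) auto
    finally show ?thesis using d by (simp add: a'_def field_simps)
  qed
  define E where "E = {T \<in> space P. \<forall>p. a ^ p \<le> tr d ((\<Sum>j<n. ?Y (T j)) ^ p)}"
  define E' where "E' = {T \<in> space P. \<forall>p. a' ^ p \<le> tr d ((\<Sum>j<n. 1 - ?Y (T j)) ^ p)}"
  have eff: "effect (?Y T)" for T by (rule effect_frame_effect[OF R])
  have int: "integrable D (\<lambda>T. ent (?Y T) d i l)" for i l
    by (rule integrable_frame_effect[OF D R])
  have mean: "(\<integral>T. ent (?Y T) d i l \<partial>D) = (if i = l then of_real (1 / d) else 0)" if "i < d" "l < d" for i l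
    by (rule mean_frame_effect[OF K R D AE_K tight AE_R that])
  have E: "E \<in> sets P" "measure P E \<le> d * exp (- \<kappa> * real n / real d)"
  proof -
    \<comment> \<open>The parameter \<open>ln (1 + \<delta>)\<close> is the maximiser for the rate
      at \<open>1 + \<delta>\<close>.\<close>
    note tail = trace_moment_tail[where Y = ?Y and \<mu> = "1 / d" and \<theta> = "ln (1 + \<delta>)" and a = a and n = n and d = d,
        OF D(1) eff _ _ int mean _ a, folded P_def, folded E_def]
    show "E \<in> sets P" using tail(1) d \<delta> by simp
    have "measure P E \<le> d * exp (- ln (1 + \<delta>) * a) * (1 - 1 / d + 1 / d * exp (ln (1 + \<delta>))) ^ n"
      using d \<delta> by (intro tail(2)) auto
    also have "1 - 1 / d + 1 / d * exp (ln (1 + \<delta>)) = 1 + \<delta> / d"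
      using d \<delta> by (simp add: field_simps)
    also have "d * exp (- ln (1 + \<delta>) * a) * (1 + \<delta> / d) ^ n \<le> d * exp (- ln (1 + \<delta>) * a) * exp (n * (\<delta> / d))"
    proof (intro mult_left_mono one_plus_power_le_exp)
      have "0 \<le> \<delta> / d" using \<delta> by simp
      then show "- 1 \<le> \<delta> / d" by linarith
    qed simp
    also have "\<dots> = d * exp (- ln (1 + \<delta>) * a + n * (\<delta> / d))"
      by (simp only: mult.assoc exp_add)
    also have "- ln (1 + \<delta>) * a + n * (\<delta> / d) = - chernoff_rate (1 + \<delta>) * (n / d)"
      using d by (simp add: chernoff_rate_def a_def field_simps)
    also have "d * exp (- chernoff_rate (1 + \<delta>) * (n / d)) \<le> d * exp (- \<kappa> * (n / d))"
      using \<kappa> by (intro mult_left_mono exp_le_cancel_iff[THEN iffD2] mult_right_mono) auto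
    finally show "measure P E \<le> d * exp (- \<kappa> * real n / real d)" by simp
  qed
  have E': "E' \<in> sets P" "measure P E' \<le> d * exp (- \<kappa> * real n / real d)"
  proof -
    have one: "(\<integral>T. ent 1 d i l \<partial>D) = (if i = l then 1 else 0)" if "i < d" "l < d" for i l
      using that D(1) by (simp add: one_matfam.rep_eq prob_space.prob_space)
    have int1: "integrable D (\<lambda>T. ent 1 d i l)" for i l
      using D(1) by (simp add: prob_space.finite_measure finite_measure.integrable_const)
    have int': "integrable D (\<lambda>T. ent (1 - ?Y T) d i l)" for i l
      unfolding minus_matfam.rep_eq by (intro Bochner_Integration.integrable_diff int int1)
    have mean': "(\<integral>T. ent (1 - ?Y T) d i l \<partial>D) = (if i = l then of_real (1 - 1 / d) else 0)"
      if "i < d" "l < d" for i l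
      using one[OF that] mean[OF that]
      unfolding minus_matfam.rep_eq Bochner_Integration.integral_diff[OF int1 int] by simp
    note tail = trace_moment_tail[where Y = "\<lambda>T. 1 - ?Y T" and \<mu> = "1 - 1 / d" and \<theta> = "- ln (1 - \<delta>)" and a = a' and n = n and d = d,
        OF D(1) effect_compl[OF eff] _ _ int' mean' _ a', folded P_def, folded E'_def]
    show "E' \<in> sets P" using tail(1) d \<delta> by simp
    have "measure P E' \<le> d * exp (- (- ln (1 - \<delta>)) * a') * (1 - (1 - 1 / d) + (1 - 1 / d) * exp (- ln (1 - \<delta>))) ^ n"
      using d \<delta> by (intro tail(2)) auto
    \<comment> \<open>Pulling out \<open>exp \<theta>\<close> leaves a base close to 1; its
      \<open>n\<close>-th power cancels the summand \<open>n\<close> of \<open>a'\<close> in the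
      exponent.\<close>
    also have "1 - (1 - 1 / d) + (1 - 1 / d) * exp (- ln (1 - \<delta>)) = exp (- ln (1 - \<delta>)) * (1 + - \<delta> / d)"
      using d \<delta> by (simp add: exp_minus field_simps)
    also have "d * exp (- (- ln (1 - \<delta>)) * a') * (exp (- ln (1 - \<delta>)) * (1 + - \<delta> / d)) ^ n
        = d * exp (- (- ln (1 - \<delta>)) * a') * exp (n * - ln (1 - \<delta>)) * (1 + - \<delta> / d) ^ n"
      unfolding power_mult_distrib exp_of_nat_mult by simp
    also have "\<dots> \<le> d * exp (- (- ln (1 - \<delta>)) * a') * exp (n * - ln (1 - \<delta>)) * exp (n * (- \<delta> / d))"
    proof (intro mult_left_mono one_plus_power_le_exp)
      show "- 1 \<le> - \<delta> / d" using d \<delta> by (simp add: field_simps)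
    qed simp
    also have "\<dots> = d * exp (- (- ln (1 - \<delta>)) * a' + n * - ln (1 - \<delta>) + n * (- \<delta> / d))"
      by (simp only: mult.assoc exp_add)
    also have "- (- ln (1 - \<delta>)) * a' + n * - ln (1 - \<delta>) + n * (- \<delta> / d) = - chernoff_rate (1 - \<delta>) * (n / d)"
      using d by (simp add: chernoff_rate_def a'_def field_simps)
    also have "d * exp (- chernoff_rate (1 - \<delta>) * (n / d)) \<le> d * exp (- \<kappa> * (n / d))"
      using \<kappa> by (intro mult_left_mono exp_le_cancel_iff[THEN iffD2] mult_right_mono) auto
    finally show "measure P E' \<le> d * exp (- \<kappa> * real n / real d)" by simp
  qed
  have S: "?S \<in> sets P"
    unfolding P_def by (rule sets_frame_event[OF K d D(2)])
  have "AE Ts in P. \<forall>j\<in>{..<n}. hs_norm_sq d r (Ts j) = R"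
    unfolding P_def using D AE_R by (intro AE_finite_allI AE_PiM_component) auto
  then have "AE Ts in P. Ts \<in> ?S \<union> (E \<union> E')"
    using AE_space
  proof eventually_elim
    case (elim Ts)
    have "Ts \<in> ?S" if "Ts \<notin> E" "Ts \<notin> E'"
    proof -
      \<comment> \<open>One violated moment on each side suffices, and the two orders are
        unrelated.\<close>
      from that elim(2) obtain p p' where p: "tr d (H Ts ^ p) < a ^ p" "tr d (H' Ts ^ p') < a' ^ p'"
        by (auto simp: E_def E'_def H_def H'_def not_le)
      have psd: "psd (H Ts)" "psd (H' Ts)"
        unfolding H_def H'_def using eff by (auto simp: effect_def intro!: psd_sum)
      have H': "H' Ts = real n *\<^sub>R 1 - H Ts"
        by (simp add: H_def H'_def sum_subtractf scaleR_conv_of_real)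
      define M where "M = 1 - (d / n) *\<^sub>R H Ts"
      have "\<bar>tr d (outer d x * M)\<bar> \<le> \<delta>" if x: "vnorm d x = 1" for x
      proof -
        let ?l = "tr d (outer d x * H Ts)"
        have X: "effect (outer d x)" "tr d (outer d x) = 1"
          using effect_sum_outer[of d "\<lambda>_. x" "{0::nat}"] x by (auto simp: tr_outer)
        have "?l ^ p < a ^ p"
          using tr_state_power_le[OF X psd(1), of p] p(1) by simp
        then have up: "?l < a" using a by (rule power_less_imp_less_base)
        have "tr d (outer d x * H' Ts) ^ p' < a' ^ p'"
          using tr_state_power_le[OF X psd(2), of p'] p(2) by simp
        then have "tr d (outer d x * H' Ts) < a'" using a' by (rule power_less_imp_less_base)
        then have low: "n - ?l < a'"
          by (simp add: H' right_diff_distrib tr_diff tr_scaleR X)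
        have "tr d (outer d x * M) = 1 - d / n * ?l"
          by (simp add: M_def right_diff_distrib tr_diff tr_scaleR X)
        moreover have "d / n * ?l \<le> d / n * a" "d / n * (n - a') \<le> d / n * ?l"
          using up low by (intro mult_left_mono; simp)+
        moreover have "d / n * a = 1 + \<delta>" "d / n * (n - a') = 1 - \<delta>"
          using d n by (simp_all add: a_def a'_def)
        ultimately show ?thesis by (simp add: abs_le_iff)
      qed
      moreover have "star M = M" using psd_star[OF psd(1)] by (simp add: M_def)
      ultimately have le: "vnorm d (\<lambda>i. \<Sum>l<d. ent M d i l * x l) \<le> \<delta> * vnorm d x" for x
        using \<delta>(1) by (intro vnorm_le_of_quadratic_form)
      have ent: "id_minus d (frame_op d r R n Ts) (i, l) = ent M d i l" if "i < d" "l < d" for i l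
      proof -
        have "frame_op d r R n Ts (i, l) = of_real (d / n) * (\<Sum>j<n. ent (?Y (Ts j)) d i l)"
          unfolding frame_op_def split sum_distrib_left[of "of_real (d / n)"]
          using elim that by (intro sum.cong refl) (simp add: ent_frame_effect)
        then show ?thesis
          using that by (simp add: id_minus_def M_def H_def ent_simps ent_sum scaleR_conv_of_real[where 'a=complex])
      qed
      have "vnorm d (mat_mult_vec d (id_minus d (frame_op d r R n Ts)) x) \<le> \<delta> * vnorm d x" for x
        using le[of x] by (simp add: vnorm_def mat_mult_vec_def ent)
      then have "spec_norm K d (id_minus d (frame_op d r R n Ts)) \<le> \<delta>"
        by (intro spec_norm_le K d)
      then show ?thesis using elim(2) \<delta>(3) by simp
    qed
    then show ?case by blast
  qed
  then have "measure P (space P) \<le> measure P (?S \<union> (E \<union> E'))"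
    using S E(1) E'(1) by (intro P.finite_measure_mono_AE) auto
  also have "\<dots> \<le> measure P ?S + (measure P E + measure P E')"
    using S E(1) E'(1)
    by (intro order_trans[OF measure_Un_le] add_left_mono measure_Un_le sets.Un) auto
  finally show ?thesis using E(2) E'(2) by (simp add: P.prob_space)
qed

text \<open>For dimension one the condition on \<open>n\<close> is void and the factor 2 cannot be
  absorbed. But each summand is then almost surely constant, so the deviation vanishes once
  \<open>n\<close> is positive.\<close>

lemma frame_dimension_one:
  fixes n :: nat
  assumes K: "K = \<real> \<or> K = UNIV" and n: "1 \<le> n" and R: "R > 0"
    and D: "prob_space D" "sets D = sets (matspace 1 r)"
    and AE_R: "AE T in D. hs_norm_sq 1 r T = R" and "0 < \<epsilon>"
  defines "P \<equiv> PiM {..<n} (\<lambda>_. D)"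
  shows "measure P {Ts \<in> space P. spec_norm K 1 (id_minus 1 (frame_op 1 r R n Ts)) < \<epsilon>} = 1"
proof -
  interpret P: prob_space P unfolding P_def by (intro prob_space_PiM D)
  have S: "{Ts \<in> space P. spec_norm K 1 (id_minus 1 (frame_op 1 r R n Ts)) < \<epsilon>} \<in> sets P"
    unfolding P_def by (rule sets_frame_event[OF K order_refl D(2)])
  have "AE Ts in P. \<forall>j\<in>{..<n}. hs_norm_sq 1 r (Ts j) = R"
    unfolding P_def using D AE_R by (intro AE_finite_allI AE_PiM_component) auto
  then have "AE Ts in P. spec_norm K 1 (id_minus 1 (frame_op 1 r R n Ts)) < \<epsilon>"
  proof eventually_elim
    case (elim Ts)
    have "frame_op 1 r R n Ts (0, 0) = (\<Sum>j<n. complex_of_real (1 / (n * R)) * complex_of_real R)"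
      unfolding frame_op_def split
    proof (intro sum.cong refl arg_cong2[of _ _ _ _ "(*)"])
      fix j assume "j \<in> {..<n}"
      then have "complex_of_real (\<Sum>k<r. (cmod (Ts j (0, k)))\<^sup>2) = complex_of_real R"
        using elim by (simp add: hs_norm_sq_def)
      then show "(\<Sum>k<r. Ts j (0, k) * cnj (Ts j (0, k))) = complex_of_real R"
        unfolding of_real_sum complex_norm_square .
    qed simp
    then have "frame_op 1 r R n Ts (0, 0) = 1" using n R by simp
    then have "spec_norm K 1 (id_minus 1 (frame_op 1 r R n Ts)) \<le> 0"
      by (intro spec_norm_le K) (simp_all add: vnorm_def mat_mult_vec_def id_minus_def)
    then show ?case using \<open>0 < \<epsilon>\<close> by simp
  qed
  then show ?thesis using S AE_space by (subst P.prob_eq_1) auto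
qed

theorem theorem4p2:
  fixes K :: "complex set" and \<epsilon> :: real
  assumes "K = \<real> \<or> K = UNIV"
    and "0 < \<epsilon>" and "\<epsilon> \<le> 1"
  shows "\<exists>\<gamma>>0. \<exists>c>0. \<forall>d r R (D :: (nat \<times> nat \<Rightarrow> complex) measure) n.
     d \<ge> 1 \<and> r \<ge> 1 \<and> R > 0 \<and>
     prob_space D \<and> sets D = sets (matspace d r) \<and>
     (AE T in D. T \<in> kmats K d r) \<and>
     tight_rgframe K d r D 1 \<and>
     (AE T in D. hs_norm_sq d r T = R) \<and>
     real n \<ge> c * real d * ln (real d)
     \<longrightarrow> measure (PiM {..<n} (\<lambda>_. D))
           {Ts \<in> space (PiM {..<n} (\<lambda>_. D)). spec_norm K d (id_minus d (frame_op d r R n Ts)) < \<epsilon>}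
         \<ge> 1 - exp (- \<gamma> * real n / real d)"
proof -
  \<comment> \<open>Halving keeps \<open>1 - \<delta>\<close> positive even for
    \<open>\<epsilon> = 1\<close> and turns the non-strict norm bound into a strict one.\<close>
  define \<delta> where "\<delta> = \<epsilon> / 2"
  have \<delta>: "0 < \<delta>" "\<delta> < 1" "\<delta> < \<epsilon>" using assms by (auto simp: \<delta>_def)
  define \<kappa> where "\<kappa> = min (chernoff_rate (1 + \<delta>)) (chernoff_rate (1 - \<delta>))"
  have \<kappa>: "0 < \<kappa>" "\<kappa> \<le> chernoff_rate (1 + \<delta>)" "\<kappa> \<le> chernoff_rate (1 - \<delta>)"
    using chernoff_rate_pos[of "1 + \<delta>"] chernoff_rate_pos[of "1 - \<delta>"] \<delta> by (auto simp: \<kappa>_def)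
  have main: "1 - exp (- (\<kappa> / 2) * real n / real d)
      \<le> measure (PiM {..<n} (\<lambda>_. D))
           {Ts \<in> space (PiM {..<n} (\<lambda>_. D)). spec_norm K d (id_minus d (frame_op d r R n Ts)) < \<epsilon>}"
    if d: "d \<ge> 1" and R: "R > 0" and D: "prob_space D" "sets D = sets (matspace d r)"
      and AE_K: "AE T in D. T \<in> kmats K d r" and tight: "tight_rgframe K d r D 1"
      and AE_R: "AE T in D. hs_norm_sq d r T = R"
      and n: "4 / \<kappa> * real d * ln (real d) \<le> real n"
    for d r n :: nat and R and D :: "(nat \<times> nat \<Rightarrow> complex) measure"
  proof -
    consider "n = 0" | "n \<ge> 1" "d = 1" | "n \<ge> 1" "d \<ge> 2" using d by linarith
    then show ?thesis
    proof cases
      case 1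
      \<comment> \<open>For \<open>n = 0\<close> the claimed lower bound is 0.\<close>
      then show ?thesis by (simp add: measure_nonneg)
    next
      case 2
      have "sets D = sets (matspace 1 r)" "AE T in D. hs_norm_sq 1 r T = R"
        using D(2) AE_R by (simp_all only: 2(2))
      from frame_dimension_one[OF assms(1) 2(1) R D(1) this assms(2)] show ?thesis
        unfolding 2(2) by (simp only:) simp
    next
      case 3
      \<comment> \<open>For \<open>d \<ge> 2\<close> the factor 2d is at most exp of 2 ln d, and the
        constant \<open>4 / \<kappa>\<close> is chosen so that half of the exponent
        \<open>\<kappa> * n / d\<close> pays for it; the other half is the rate
        \<open>\<kappa> / 2\<close>.\<close>
      have "2 * real d \<le> real d * real d" using 3 by (intro mult_right_mono) auto
      also have "\<dots> = exp (ln (real d) + ln (real d))" using 3 by (simp only: exp_add) simp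
      also have "ln (real d) + ln (real d) \<le> \<kappa> / 2 * (n / d)"
        using n 3 \<kappa>(1) by (simp add: field_simps)
      finally have "2 * real d * exp (- \<kappa> * n / d) \<le> exp (\<kappa> / 2 * (n / d)) * exp (- \<kappa> * n / d)"
        by (intro mult_right_mono) auto
      also have "\<dots> = exp (- (\<kappa> / 2) * n / d)"
        by (simp flip: exp_add)
      finally have "1 - exp (- (\<kappa> / 2) * n / d) \<le> 1 - 2 * real d * exp (- \<kappa> * n / d)"
        by (rule diff_left_mono)
      also note frame_concentration[OF assms(1) d 3(1) R D AE_K tight AE_R \<delta> \<kappa>(2,3)]
      finally show ?thesis .
    qed
  qed
  show ?thesis
  proof (rule exI[of _ "\<kappa> / 2"], rule conjI, goal_cases)
    case 2
    show ?case
    proof (rule exI[of _ "4 / \<kappa>"], intro conjI allI impI, goal_cases)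
      case (2 d r R D n)
      then show ?case by (intro main) simp_all
    qed (use \<kappa>(1) in simp)
  qed (use \<kappa>(1) in simp)
qed

end
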